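(* Let $\mathcal{G}=(\mathcal{V},\mathcal{E})$ be the icosahedral graph (the graph of vertices and edges of the regular icosahedron, with $12$ vertices and $30$ edges), and let $$p_{\mathcal{G},3}(x_0,x,y)=x_0^3-3x_0\left(\|x\|^2+\|y\|^2\right)+9\sum_{\{i,j\}\in\mathcal{E}}x_ix_jy_{ij},$$ a cubic form in the $43$ variables $x_0\in\mathbb{R}$, $x=(x_i)_{i\in\mathcal{V}}\in\mathbb{R}^{\mathcal{V}}$, $y=(y_{ij})_{\{i,j\}\in\mathcal{E}}\in\mathbb{R}^{\mathcal{E}}$. Then $p_{\mathcal{G},3}$ is hyperbolic, but not SOS-hyperbolic, with respect to $e_0$.
   Context: $\|\cdot\|$ is the Euclidean norm and $e_0$ is the standard basis vector with $x_0=1$, $x=0$, $y=0$. A homogeneous polynomial $p$ of degree $d$ on $\mathbb{R}^n$ is hyperbolic with respect to $e\in\mathbb{R}^n$ if $p(e)>0$ and for every $x\in\mathbb{R}^n$ the polynomial $t\mapsto p(x+te)$ has only real zeros. The hyperbolicity cone $\Lambda_+(p,e)$ is the set of $x\in\mathbb{R}^n$ such that all zeros of $t\mapsto p(te-x)$ are nonnegative. For $x,u\in\mathbb{R}^n$ put $p_x(t)=p(x+te)$ and $D_up_x(t)=(D_up)(x+te)$, with $D_u$ the directional derivative. The parameterized Bézoutian $B_{p,e}(x)[u]$ is the $d\times d$ symmetric matrix (with entries polynomial in $x$) defined by $$\frac{p_x(t)\,D_up_x(s)-D_up_x(t)\,p_x(s)}{t-s}=\sum_{i,j=1}^d [B_{p,e}(x)[u]]_{ij}\,t^{i-1}s^{j-1}.$$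 A symmetric matrix $P(x)$ with polynomial entries is a matrix sum of squares if $P(x)=Q(x)Q(x)^T$ for some (possibly rectangular) matrix $Q$ with real polynomial entries. A polynomial $p$ hyperbolic with respect to $e$ is SOS-hyperbolic with respect to $e$ if $B_{p,e}(x)[u]$ is a matrix sum of squares for every $u\in\Lambda_+(p,e)$. *)

theory Defs
  imports
    "HOL-Analysis.Analysis"
    "HOL-Computational_Algebra.Polynomial"
    "Jordan_Normal_Form.Matrix"
begin

text \<open>The vector-component syntax \<open>$\<close> below is that of \<open>real ^ 'n\<close>.\<close>

unbundle no fps_syntax
no_notation vec_index (infixl "$" 100) and scalar_prod (infix "\<bullet>" 70)

section \<open>Hyperbolic and SOS-hyperbolic polynomials\<close>

text \<open>Polynomials on a Euclidean space are represented by their polynomial functions.\<close>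

definition homogeneous_poly :: "nat \<Rightarrow> ('a::euclidean_space \<Rightarrow> real) \<Rightarrow> bool" where
  "homogeneous_poly d p \<longleftrightarrow>
     real_polynomial_function p \<and> (\<forall>c x. p (c *\<^sub>R x) = c ^ d * p x)"

definition line_poly :: "('a::euclidean_space \<Rightarrow> real) \<Rightarrow> 'a \<Rightarrow> 'a \<Rightarrow> real poly" where
  "line_poly p x e = (THE q. \<forall>t. poly q t = p (x + t *\<^sub>R e))"

lemma poly_line_poly:
  assumes "real_polynomial_function p"
  shows "poly (line_poly p x e) t = p (x + t *\<^sub>R e)"
proof -
  have pf: "polynomial_function (\<lambda>t::real. x + t *\<^sub>R e)"
  proof (rule polynomial_function_add)
    show "polynomial_function (\<lambda>t::real. x)" by (rule polynomial_function_const)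
    show "polynomial_function (\<lambda>t::real. t *\<^sub>R e)"
      by (rule polynomial_function_bounded_linear, rule bounded_linear_scaleR_left)
  qed
  have "real_polynomial_function (p \<circ> (\<lambda>t::real. x + t *\<^sub>R e))"
    by (rule real_polynomial_function_compose[OF pf assms])
  then obtain a n where a: "(p \<circ> (\<lambda>t. x + t *\<^sub>R e)) = (\<lambda>t. \<Sum>i\<le>n. a i * t ^ i)"
    using real_polynomial_function_iff_sum by blast
  have "\<forall>t. poly (\<Sum>i\<le>n. monom (a i) i) t = p (x + t *\<^sub>R e)"
    using fun_cong[OF a] by (simp add: poly_sum poly_monom)
  then have "\<exists>!q. \<forall>t. poly q t = p (x + t *\<^sub>R e)"
    by (intro ex1I) (auto simp flip: poly_eq_poly_eq_iff)
  then show ?thesis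
    unfolding line_poly_def by (rule theI'[THEN spec])
qed

definition hyperbolic :: "nat \<Rightarrow> ('a::euclidean_space \<Rightarrow> real) \<Rightarrow> 'a \<Rightarrow> bool" where
  "hyperbolic d p e \<longleftrightarrow> homogeneous_poly d p \<and> p e > 0 \<and>
     (\<forall>x z. poly (map_poly complex_of_real (line_poly p x e)) z = 0 \<longrightarrow> z \<in> \<real>)"

text \<open>It suffices to consider real zeros here, as the cone is only used for hyperbolic \<open>p\<close>.\<close>

definition hyperbolicity_cone :: "('a::euclidean_space \<Rightarrow> real) \<Rightarrow> 'a \<Rightarrow> 'a set" where
  "hyperbolicity_cone p e = {x. \<forall>t. p (t *\<^sub>R e - x) = 0 \<longrightarrow> t \<ge> 0}"

definition dir_deriv :: "'a::euclidean_space \<Rightarrow> ('a \<Rightarrow> real) \<Rightarrow> 'a \<Rightarrow> real" where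
  "dir_deriv u p x = deriv (\<lambda>r. p (x + r *\<^sub>R u)) 0"

text \<open>
  Matrix indices start at \<open>0\<close>, so entry \<open>(i, j)\<close> belongs to \<open>t ^ i * s ^ j\<close>.
  The identity at all \<open>t \<noteq> s\<close> determines the coefficients of the polynomial on the right.
\<close>

definition bezoutian ::
  "nat \<Rightarrow> ('a::euclidean_space \<Rightarrow> real) \<Rightarrow> 'a \<Rightarrow> 'a \<Rightarrow> 'a \<Rightarrow> real mat" where
  "bezoutian d p e x u = (THE B. B \<in> carrier_mat d d \<and>
     (\<forall>t s. t \<noteq> s \<longrightarrow>
        (p (x + t *\<^sub>R e) * dir_deriv u p (x + s *\<^sub>R e)
           - dir_deriv u p (x + t *\<^sub>R e) * p (x + s *\<^sub>R e)) / (t - s)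
        = (\<Sum>i<d. \<Sum>j<d. B $$ (i, j) * t ^ i * s ^ j)))"

definition matrix_sos :: "nat \<Rightarrow> ('a::euclidean_space \<Rightarrow> real mat) \<Rightarrow> bool" where
  "matrix_sos d P \<longleftrightarrow> (\<exists>m (Q :: 'a \<Rightarrow> real mat).
     (\<forall>x. Q x \<in> carrier_mat d m) \<and>
     (\<forall>i<d. \<forall>k<m. real_polynomial_function (\<lambda>x. Q x $$ (i, k))) \<and>
     (\<forall>x. P x = Q x * transpose_mat (Q x)))"

definition SOS_hyperbolic :: "nat \<Rightarrow> ('a::euclidean_space \<Rightarrow> real) \<Rightarrow> 'a \<Rightarrow> bool" where
  "SOS_hyperbolic d p e \<longleftrightarrow> hyperbolic d p e \<and>
     (\<forall>u \<in> hyperbolicity_cone p e. matrix_sos d (\<lambda>x. bezoutian d p e x u))"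

section \<open>The cubic form of a graph\<close>

text \<open>
  The graph has vertex set \<open>'v\<close>; its edges are indexed by \<open>'e\<close>, and \<open>E\<close> maps
  each index to the two-element set of its endpoints.
\<close>

definition graph_cubic ::
  "('e::finite \<Rightarrow> 'v::finite set) \<Rightarrow> real \<times> (real ^ 'v) \<times> (real ^ 'e) \<Rightarrow> real" where
  "graph_cubic E = (\<lambda>(x0, x, y).
     x0 ^ 3 - 3 * x0 * ((norm x)\<^sup>2 + (norm y)\<^sup>2)
       + 9 * (\<Sum>e\<in>UNIV. (\<Prod>i\<in>E e. x $ i) * y $ e))"

section \<open>The icosahedral graph\<close>

definition golden :: real where "golden = (1 + sqrt 5) / 2"

text \<open>
  The standard coordinates of a regular icosahedron with edge length \<open>2\<close>: the cyclic
  permutations of \<open>(0, \<plusminus>1, \<plusminus>golden)\<close>.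
\<close>

definition ico_points :: "(real ^ 3) set" where
  "ico_points = (\<Union>a\<in>{1, -1}. \<Union>b\<in>{golden, - golden}.
     {vector [0, a, b], vector [a, b, 0], vector [b, 0, a]})"

definition icosahedron :: "(real ^ 3) set" where
  "icosahedron = convex hull ico_points"

lemma finite_ico_points: "finite ico_points"
  by (simp add: ico_points_def)

typedef ico_vertex = "{v. v extreme_point_of icosahedron}"
  morphisms ico_point Abs_ico_vertex
proof -
  have "ico_points \<noteq> {}" by (simp add: ico_points_def)
  then obtain x where "x extreme_point_of icosahedron"
    using extreme_point_exists_convex[of icosahedron] finite_ico_points
    unfolding icosahedron_def
    by (metis compact_convex_hull convex_convex_hull convex_hull_eq_empty finite_imp_compact)
  then show ?thesis by blast
qed

instance ico_vertex :: finite
proof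
  have "range ico_point \<subseteq> ico_points"
    using ico_point extreme_points_of_convex_hull by (fastforce simp: icosahedron_def)
  then show "finite (UNIV :: ico_vertex set)"
    by (meson finite_ico_points finite_imageD finite_subset ico_point_inject inj_onI)
qed

definition ico_edges :: "ico_vertex set set" where
  "ico_edges = {{v, w} |v w. v \<noteq> w \<and>
     closed_segment (ico_point v) (ico_point w) edge_of icosahedron}"

lemma golden_gt_1: "golden > 1"
  unfolding golden_def using real_less_rsqrt[of 1 5] by simp

lemma ico_edges_nonempty: "ico_edges \<noteq> {}"
proof -
  define v w :: "real ^ 3" where "v = vector [0, 1, golden]" and "w = vector [0, -1, golden]"
  define T where "T = icosahedron \<inter> {x. axis 3 1 \<bullet> x = golden}"
  have vw: "v \<in> ico_points" "w \<in> ico_points" by (auto simp: v_def w_def ico_points_def)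
  have ne: "v \<noteq> w"
  proof
    assume "v = w"
    then have "v $ 2 = w $ 2" by simp
    then show False by (simp add: v_def w_def)
  qed
  have "ico_points \<subseteq> {x. axis 3 1 \<bullet> x \<le> golden}"
    using golden_gt_1 by (auto simp: ico_points_def inner_axis')
  then have le: "icosahedron \<subseteq> {x. axis 3 1 \<bullet> x \<le> golden}"
    unfolding icosahedron_def by (intro hull_minimal convex_halfspace_le)
  have T: "T face_of icosahedron"
    unfolding T_def using le
    by (intro face_of_Int_supporting_hyperplane_le) (auto simp: icosahedron_def)
  then obtain S where S: "S \<subseteq> ico_points" "T = convex hull S"
    using face_of_convex_hull_subset finite_imp_compact[OF finite_ico_points]
    unfolding icosahedron_def by metis
  have "S \<subseteq> {v, w}"
  proof
    fix x assume x: "x \<in> S"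
    then have "axis 3 1 \<bullet> x = golden" using S(2) hull_inc[OF x] by (auto simp: T_def)
    then show "x \<in> {v, w}" using x S(1) golden_gt_1
      by (auto simp: ico_points_def inner_axis' v_def w_def)
  qed
  then have "T \<subseteq> closed_segment v w"
    unfolding S(2) segment_convex_hull by (rule hull_mono)
  moreover have "v \<in> T" "w \<in> T"
    using vw by (auto simp: T_def icosahedron_def inner_axis' v_def w_def intro: hull_inc)
  then have "closed_segment v w \<subseteq> T"
    using T face_of_imp_convex closed_segment_subset by blast
  ultimately have eq: "T = closed_segment v w" by blast
  have edge: "closed_segment v w edge_of icosahedron"
    using T ne by (simp add: edge_of_def eq segment_convex_hull aff_dim_convex_hull aff_dim_2)
  have "{v} face_of closed_segment v w" "{w} face_of closed_segment v w"
    by (simp_all add: face_of_singleton extreme_point_of_segment)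
  then have "v extreme_point_of icosahedron" "w extreme_point_of icosahedron"
    using T eq face_of_trans face_of_singleton by metis+
  then obtain v' w' where "v = ico_point v'" "w = ico_point w'"
    by (metis Abs_ico_vertex_inverse mem_Collect_eq)
  with ne edge show ?thesis unfolding ico_edges_def by blast
qed

typedef ico_edge = ico_edges
  morphisms ico_ends Abs_ico_edge
  using ico_edges_nonempty by blast

instance ico_edge :: finite
proof
  show "finite (UNIV :: ico_edge set)"
    by (metis finite finite_imageD ico_ends_inject inj_onI)
qed

end

theory Submission
  imports Defs
begin

text \<open>
  Write \<open>z = (x, y)\<close> and \<open>p(x\<^sub>0, z) = x\<^sub>0\<^sup>3 - 3 x\<^sub>0 \<parallel>z\<parallel>\<^sup>2 + 2 q(z)\<close>, where \<open>2 q\<close> is nine times the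
  sum of \<open>x\<^sub>i x\<^sub>j y\<^sub>i\<^sub>j\<close> over the edges (\<open>edge_form\<close>).

  Hyperbolicity follows from \<open>q\<^sup>2 \<le> \<parallel>z\<parallel>\<^sup>6\<close>, since a cubic \<open>t\<^sup>3 - 3 N t + 2 q\<close> with \<open>q\<^sup>2 \<le> N\<^sup>3\<close> has only real
  roots. By the Cauchy--Schwarz inequality, \<open>q\<^sup>2\<close> is at most \<open>81/4 \<parallel>y\<parallel>\<^sup>2\<close> times the sum of
  \<open>x\<^sub>i\<^sup>2 x\<^sub>j\<^sup>2\<close> over the edges. The icosahedral graph has no clique with four vertices, so this sum is
  at most \<open>\<parallel>x\<parallel>\<^sup>4 / 3\<close> by the theorem of Motzkin and Straus (\<open>motzkin_straus\<close>), and the inequality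
  of the arithmetic and geometric means finishes the proof (\<open>edge_form_bound\<close>).

  For the second claim the direction \<open>u = e\<^sub>0\<close> suffices. If the Bezoutian is a matrix sum of squares
  \<open>Q Q\<^sup>T\<close>, then for \<open>x\<^sub>0 = 0\<close> a completion of squares yields polynomials \<open>f\<^sub>k\<close> and \<open>l\<^sub>k\<close> in \<open>z\<close> with
  sums \<open>\<Sum> f\<^sub>k\<^sup>2 = \<parallel>z\<parallel>\<^sup>4\<close>, \<open>\<Sum> f\<^sub>k l\<^sub>k = q\<close> and \<open>\<Sum> l\<^sub>k\<^sup>2 = \<parallel>z\<parallel>\<^sup>2\<close>. Their growth makes the \<open>f\<^sub>k\<close> quadratic forms
  and the \<open>l\<^sub>k\<close> linear forms, so \<open>f\<close> is a quadratic map into a Euclidean space with \<open>|f(z)| = \<parallel>z\<parallel>\<^sup>2\<close>, and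
  \<open>l\<close> is a linear map. Where \<open>\<parallel>z\<parallel> = 3\<close> and \<open>q(z) = 27\<close>, the sum \<open>\<Sum> (f\<^sub>k - 3 l\<^sub>k)\<^sup>2 = 81 - 6 * 27 + 81\<close>
  vanishes, so \<open>f = 3 l\<close> there. Each triangle of the graph carries such points, one for every choice
  of signs (\<open>triangle_point\<close>). Averaging over the signs yields, with \<open>u\<^sub>i\<close> the basis vector of a vertex
  scaled by \<open>sqrt 2\<close>, \<open>w\<^sub>e\<close> that of an edge and \<open>B\<close> the bilinear map of \<open>f\<close>, two relations for a
  triangle \<open>a, b, c\<close> (\<open>triangle_relations\<close>):
  \<^item> \<open>2 B(u\<^sub>b, w\<^sub>a\<^sub>b) + 2 B(u\<^sub>c, w\<^sub>a\<^sub>c) = 3 l(u\<^sub>a)\<close>;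
  \<^item> the values of \<open>f\<close> at \<open>u\<^sub>a, u\<^sub>b, u\<^sub>c, w\<^sub>a\<^sub>b, w\<^sub>a\<^sub>c, w\<^sub>b\<^sub>c\<close> sum to zero.

  Now take a vertex \<open>h\<close> and the 5-cycle of its neighbours. As the cycle is odd, the first
  relation determines each \<open>B(u\<^sub>j, w\<^sub>h\<^sub>j) = 3/4 l(u\<^sub>h)\<close>. Hence \<open>H = f(u\<^sub>h)\<close> and
  \<open>V\<^sub>j = f(u\<^sub>j) + f(w\<^sub>h\<^sub>j)\<close> satisfy \<open>|H|\<^sup>2 = 4\<close> and \<open>|V\<^sub>j|\<^sup>2 = 9/2\<close>, and the second relation gives
  \<open>|H + V\<^sub>j + V\<^sub>j\<^sub>+\<^sub>1|\<^sup>2 = 1\<close> for neighbours on the cycle. No six vectors in a Euclidean space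
  satisfy these equations (\<open>no_pentagon_gram\<close>).
\<close>

section \<open>The icosahedral graph\<close>

lemma golden_mult_golden: "golden * golden = golden + 1"
  by (simp add: golden_def field_simps)

lemma golden_mult_golden_mult: "golden * (golden * x) = golden * x + x"
  using golden_mult_golden by (simp add: mult.assoc[symmetric] distrib_right)

lemmas golden_simps = algebra_simps golden_mult_golden golden_mult_golden_mult

text \<open>The vertices are numbered so that \<open>i\<close> and \<open>11 - i\<close> are antipodal.\<close>

definition ico_pt :: "nat \<Rightarrow> real ^ 3" where
  "ico_pt i =
    [vector [0, 1, golden],
     vector [0, -1, golden],
     vector [golden, 0, 1],
     vector [1, golden, 0],
     vector [-1, golden, 0],
     vector [- golden, 0, 1],
     vector [golden, 0, -1],
     vector [1, - golden, 0],
     vector [-1, - golden, 0],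
     vector [- golden, 0, -1],
     vector [0, 1, - golden],
     vector [0, -1, - golden]] ! i"

lemmas ico_pt_coords = ico_pt_def inner_vec_def sum_3 Finite_Cartesian_Product.vec_eq_iff forall_3

lemma lessThan_12: "{..<12} = {0, 1, 2, 3, 4, 5, 6, 7, 8, 9, 10, 11::nat}"
  by (auto simp: numeral_eq_Suc less_Suc_eq)

lemma ico_points_eq: "ico_points = ico_pt ` {..<12}"
  unfolding lessThan_12 by (auto simp: ico_points_def ico_pt_def)

lemma ico_pt_antipodal:
  assumes "i + j = 11"
  shows "ico_pt j = - ico_pt i"
proof -
  have "i \<in> {..<12}" "j = 11 - i" using assms by auto
  then show ?thesis unfolding lessThan_12 by (auto simp: ico_pt_coords)
qed

lemma ico_point_square: "p \<in> ico_points \<Longrightarrow> p \<bullet> p = golden + 2"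
  by (auto simp: ico_points_def inner_vec_def sum_3 golden_simps)

lemma ico_points_inner_le:
  assumes "p \<in> ico_points" "q \<in> ico_points" "p \<noteq> q"
  shows "p \<bullet> q \<le> golden"
  using assms golden_gt_1 by (auto simp: ico_points_def inner_vec_def sum_3 golden_simps)

text \<open>The thirty edges as pairs of indices, the smaller one first.\<close>

definition ico_adjacent :: "(nat \<times> nat) list" where
  "ico_adjacent =
    [(0, 1), (0, 2), (0, 3), (0, 4), (0, 5), (1, 2), (1, 5), (1, 7), (1, 8), (2, 3),
     (2, 6), (2, 7), (3, 4), (3, 6), (3, 10), (4, 5), (4, 9), (4, 10), (5, 8), (5, 9),
     (6, 7), (6, 10), (6, 11), (7, 8), (7, 11), (8, 9), (8, 11), (9, 10), (9, 11), (10, 11)]"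

text \<open>
  The pairs of vertices at distance two in the graph, each followed by its two common neighbours.
  The four points are the vertices of a skew rhombus with the two pairs as diagonals.
\<close>

definition ico_rhombi :: "(nat \<times> nat \<times> nat \<times> nat) list" where
  "ico_rhombi =
    [(0, 6, 2, 3), (0, 7, 1, 2), (0, 8, 1, 5), (0, 9, 4, 5), (0, 10, 3, 4),
     (1, 3, 0, 2), (1, 4, 0, 5), (1, 6, 2, 7), (1, 9, 5, 8), (1, 11, 7, 8),
     (2, 4, 0, 3), (2, 5, 0, 1), (2, 8, 1, 7), (2, 10, 3, 6), (2, 11, 6, 7),
     (3, 5, 0, 4), (3, 7, 2, 6), (3, 9, 4, 10), (3, 11, 6, 10), (4, 6, 3, 10),
     (4, 8, 5, 9), (4, 11, 9, 10), (5, 7, 1, 8), (5, 10, 4, 9), (5, 11, 8, 9),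
     (6, 8, 7, 11), (6, 9, 10, 11), (7, 9, 8, 11), (7, 10, 6, 11), (8, 10, 9, 11)]"

lemma inner_ico_adjacent: "\<forall>(i, j) \<in> set ico_adjacent. ico_pt i \<bullet> ico_pt j = golden"
  by (simp add: ico_adjacent_def ico_pt_coords golden_simps)

text \<open>The midpoints of the two diagonals differ by the factor \<open>golden\<close>.\<close>

lemma ico_rhombus_diagonals:
  "\<forall>(i, j, k, l) \<in> set ico_rhombi. k < 12 \<and> l < 12 \<and>
     ico_pt k + ico_pt l = golden *\<^sub>R (ico_pt i + ico_pt j)"
  by (simp add: ico_rhombi_def ico_pt_def)
    (simp add: Finite_Cartesian_Product.vec_eq_iff forall_3 golden_simps)

lemma ico_pairs:
  "\<forall>i\<in>set [0..<12]. \<forall>j\<in>set [0..<12]. i < j \<longrightarrow>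
     (i, j) \<in> set ico_adjacent \<or> i + j = 11 \<or> (i, j) \<in> set (map (\<lambda>(i, j, k, l). (i, j)) ico_rhombi)"
  unfolding ico_adjacent_def ico_rhombi_def by code_simp

lemma ico_points_pair_cases:
  assumes "p \<in> ico_points" "q \<in> ico_points" "p \<noteq> q"
  obtains "p \<bullet> q = golden" | "q = - p"
  | a b where "a \<in> ico_points" "b \<in> ico_points" "a + b = golden *\<^sub>R (p + q)"
proof -
  have *: "ico_pt i \<bullet> ico_pt j = golden \<or> ico_pt j = - ico_pt i \<or>
      (\<exists>a\<in>ico_points. \<exists>b\<in>ico_points. a + b = golden *\<^sub>R (ico_pt i + ico_pt j))"
    if ij: "i < j" "j < 12" for i j
  proof -
    have "(i, j) \<in> set ico_adjacent \<or> i + j = 11 \<or> (\<exists>k l. (i, j, k, l) \<in> set ico_rhombi)"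
      using ico_pairs[rule_format, of i j] ij by auto
    then show ?thesis
      using inner_ico_adjacent ico_rhombus_diagonals ico_pt_antipodal
      unfolding ico_points_eq by fast
  qed
  obtain i j where ij: "p = ico_pt i" "q = ico_pt j" "i < 12" "j < 12"
    using assms by (auto simp: ico_points_eq)
  then consider "i < j" | "j < i" using assms(3) by (metis linorder_neqE_nat)
  then show thesis
  proof cases
    case 1
    then show ?thesis using *[of i j] ij that by blast
  next
    case 2
    then show ?thesis
      using *[of j i] ij that by (metis add.commute inner_commute minus_minus)
  qed
qed

lemma ico_points_subset: "ico_points \<subseteq> icosahedron"
  by (simp add: icosahedron_def hull_subset)

lemma icosahedron_uminus:
  assumes "x \<in> icosahedron"
  shows "- x \<in> icosahedron"
proof -
  have "uminus ` ico_points \<subseteq> ico_points"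
    unfolding ico_points_eq
  proof safe
    fix i :: nat assume "i < 12"
    then show "- ico_pt i \<in> ico_pt ` {..<12}"
      using ico_pt_antipodal[of i "11 - i"] by (intro image_eqI[of _ _ "11 - i"]) auto
  qed
  then have "convex hull (uminus ` ico_points) \<subseteq> icosahedron"
    unfolding icosahedron_def by (rule hull_mono)
  then have "uminus ` icosahedron \<subseteq> icosahedron"
    by (simp add: icosahedron_def convex_hull_linear_image[OF linear_uminus])
  then show ?thesis using assms by blast
qed

lemma edge_of_icosahedron_if_inner:
  assumes p: "p \<in> ico_points" and q: "q \<in> ico_points" and pq: "p \<bullet> q = golden"
  shows "closed_segment p q edge_of icosahedron"
proof -
  define T where "T = icosahedron \<inter> {x. (p + q) \<bullet> x = 2 * golden + 2}"
  have ne: "p \<noteq> q" using pq ico_point_square[OF p] by auto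
  have small: "(p + q) \<bullet> u \<le> 2 * golden" if "u \<in> ico_points" "u \<noteq> p" "u \<noteq> q" for u
    using ico_points_inner_le[OF p that(1)] ico_points_inner_le[OF q that(1)] that
    by (simp add: inner_add_left)
  have attained: "(p + q) \<bullet> p = 2 * golden + 2" "(p + q) \<bullet> q = 2 * golden + 2"
    using ico_point_square[OF p] ico_point_square[OF q] pq inner_commute[of p q]
    by (simp_all add: inner_add_left)
  have "ico_points \<subseteq> {x. (p + q) \<bullet> x \<le> 2 * golden + 2}"
    using small attained by fastforce
  then have le: "icosahedron \<subseteq> {x. (p + q) \<bullet> x \<le> 2 * golden + 2}"
    unfolding icosahedron_def by (intro hull_minimal convex_halfspace_le)
  have T: "T face_of icosahedron"
    unfolding T_def using le
    by (intro face_of_Int_supporting_hyperplane_le) (auto simp: icosahedron_def)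
  then obtain S where S: "S \<subseteq> ico_points" "T = convex hull S"
    using face_of_convex_hull_subset finite_imp_compact[OF finite_ico_points]
    unfolding icosahedron_def by metis
  have "S \<subseteq> {p, q}"
  proof
    fix x assume x: "x \<in> S"
    then have "(p + q) \<bullet> x = 2 * golden + 2" using S(2) hull_inc[OF x] by (auto simp: T_def)
    then show "x \<in> {p, q}" using small[of x] x S(1) by auto
  qed
  then have "T \<subseteq> closed_segment p q"
    unfolding S(2) segment_convex_hull by (rule hull_mono)
  moreover have "p \<in> T" "q \<in> T"
    using p q attained ico_points_subset by (auto simp: T_def)
  then have "closed_segment p q \<subseteq> T"
    using T face_of_imp_convex closed_segment_subset by blast
  ultimately have eq: "T = closed_segment p q" by blast
  show ?thesis
    using T ne by (simp add: edge_of_def eq segment_convex_hull aff_dim_convex_hull aff_dim_2)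
qed

text \<open>
  Antipodal points and points at distance two in the graph do not span a face, because a face that
  meets the interior of a segment in the icosahedron contains the segment.
\<close>

lemma inner_if_edge_of_icosahedron:
  assumes p: "p \<in> ico_points" and q: "q \<in> ico_points" and ne: "p \<noteq> q"
    and edge: "closed_segment p q edge_of icosahedron"
  shows "p \<bullet> q = golden"
proof (cases "q = - p")
  case True
  \<comment> \<open>A face through the centre contains every vertex, but two of them are not collinear with
    the centre.\<close>
  have face: "closed_segment p (- p) face_of icosahedron"
    using edge True by (simp add: edge_of_def)
  have centre: "0 \<in> closed_segment p (- p)"
    unfolding in_segment by (intro exI[of _ "1 / 2"]) simp
  have line: "\<exists>c. u = c *\<^sub>R p" if u: "u \<in> ico_points" for u
  proof -
    have "u \<noteq> - u"
    proof
      assume "u = - u"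
      then have "u \<bullet> u = - (u \<bullet> u)" by (metis inner_minus_left)
      then show False using ico_point_square[OF u] golden_gt_1 by simp
    qed
    moreover have "0 = (1 / 2) *\<^sub>R u + (1 / 2) *\<^sub>R (- u)" by simp
    ultimately have "0 \<in> open_segment u (- u)"
      unfolding in_segment by (intro conjI exI[of _ "1 / 2"]) auto
    then have "u \<in> closed_segment p (- p)"
      using face_ofD[OF face] centre u ico_points_subset icosahedron_uminus by blast
    then obtain s where "u = (1 - s) *\<^sub>R p + s *\<^sub>R (- p)" by (auto simp: in_segment)
    then have "u = (1 - s + - s) *\<^sub>R p"
      by (simp only: scaleR_add_left scaleR_minus_left scaleR_minus_right)
    then show ?thesis by blast
  qed
  obtain a where a: "ico_pt 0 = a *\<^sub>R p" using line[of "ico_pt 0"] by (auto simp: ico_points_eq)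
  obtain b where b: "ico_pt 1 = b *\<^sub>R p" using line[of "ico_pt 1"] by (auto simp: ico_points_eq)
  have "a * p $ 2 = 1" "b * p $ 2 = -1" "a * p $ 3 = golden" "b * p $ 3 = golden"
    using a b by (auto simp: ico_pt_coords)
  then have "(a * p $ 2) * (b * p $ 3) = golden" "(b * p $ 2) * (a * p $ 3) = - golden" by simp_all
  then show ?thesis using golden_gt_1 by (simp add: mult_ac)
next
  case False
  from p q ne show ?thesis
  proof (cases rule: ico_points_pair_cases)
    case (3 a b)
    \<comment> \<open>The midpoint \<open>m\<close> lies strictly between two points of the icosahedron, \<open>- m\<close> and the
      other midpoint of the rhombus, so the face would contain the latter.\<close>
    define m where "m = (1 / 2) *\<^sub>R (p + q)"
    have face: "closed_segment p q face_of icosahedron"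
      using edge by (simp add: edge_of_def)
    have m: "m \<in> closed_segment p q"
      unfolding in_segment by (intro exI[of _ "1 / 2"]) (simp add: m_def scaleR_add_right)
    then have "m \<in> icosahedron" using face face_of_imp_subset by blast
    then have inner: "- m \<in> icosahedron" by (rule icosahedron_uminus)
    have "golden *\<^sub>R m = (1 / 2) *\<^sub>R a + (1 / 2) *\<^sub>R b"
      using 3(3) by (simp add: m_def scaleR_add_right[symmetric])
    moreover have "convex icosahedron" by (simp add: icosahedron_def)
    ultimately have outer: "golden *\<^sub>R m \<in> icosahedron"
      using 3 ico_points_subset by (auto intro!: convexD)
    have pq0: "p + q \<noteq> 0" using False by (simp add: eq_neg_iff_add_eq_0 add.commute)
    define c where "c = 2 / (golden + 1)"
    have "c * (golden + 1) = 2"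
      unfolding c_def using golden_gt_1 by (intro nonzero_eq_divide_eq[THEN iffD1]) auto
    then have c: "c * golden - (1 - c) = 1" by (simp add: distrib_left)
    have c01: "0 < c" "c < 1" using golden_gt_1 by (simp_all add: c_def)
    have "m \<in> open_segment (- m) (golden *\<^sub>R m)"
      unfolding in_segment
    proof (intro conjI exI[of _ c])
      show "- m \<noteq> golden *\<^sub>R m"
      proof
        assume "- m = golden *\<^sub>R m"
        then have "(golden + 1) *\<^sub>R m = 0"
          by (metis add.left_inverse add.commute scaleR_add_left scaleR_one)
        then show False using pq0 golden_gt_1 by (simp add: m_def)
      qed
      have "(1 - c) *\<^sub>R (- m) + c *\<^sub>R (golden *\<^sub>R m) = (c * golden - (1 - c)) *\<^sub>R m"
        by (simp add: scaleR_diff_left)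
      then show "m = (1 - c) *\<^sub>R (- m) + c *\<^sub>R (golden *\<^sub>R m)" by (simp only: c scaleR_one)
    qed (use c01 in auto)
    then have "golden *\<^sub>R m \<in> closed_segment p q"
      using face_ofD[OF face] m inner outer by blast
    then obtain s where "golden *\<^sub>R m = (1 - s) *\<^sub>R p + s *\<^sub>R q" by (auto simp: in_segment)
    then have eq: "(golden *\<^sub>R m) \<bullet> (p + q) = ((1 - s) *\<^sub>R p + s *\<^sub>R q) \<bullet> (p + q)" by simp
    define D where "D = (p + q) \<bullet> (p + q)"
    have "p \<bullet> (p + q) = D / 2" "q \<bullet> (p + q) = D / 2"
      using ico_point_square[OF p] ico_point_square[OF q] inner_commute[of p q]
      by (simp_all add: D_def inner_add_left inner_add_right)
    then have right: "((1 - s) *\<^sub>R p + s *\<^sub>R q) \<bullet> (p + q) = (1 - s) * (D / 2) + s * (D / 2)"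
      by (simp only: inner_add_left[of "(1 - s) *\<^sub>R p"] inner_scaleR_left)
    have left: "(golden *\<^sub>R m) \<bullet> (p + q) = golden * (D / 2)"
      by (simp only: m_def D_def inner_scaleR_left)
    have "(golden - 1) * D = 0"
      using eq[unfolded left right] by (simp add: field_simps)
    then have "D = 0" using golden_gt_1 by simp
    then show ?thesis using pq0 by (simp add: D_def)
  qed (use False in auto)
qed

lemma ico_point_in_ico_points: "ico_point v \<in> ico_points"
  using ico_point[of v] extreme_points_of_convex_hull by (fastforce simp: icosahedron_def)

lemma ico_edges_iff:
  "{v, w} \<in> ico_edges \<longleftrightarrow> ico_point v \<bullet> ico_point w = golden"
proof
  assume "{v, w} \<in> ico_edges"
  then have "v \<noteq> w" "closed_segment (ico_point v) (ico_point w) edge_of icosahedron"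
    by (auto simp: ico_edges_def doubleton_eq_iff closed_segment_commute)
  then show "ico_point v \<bullet> ico_point w = golden"
    using inner_if_edge_of_icosahedron ico_point_in_ico_points ico_point_inject by metis
next
  assume inner: "ico_point v \<bullet> ico_point w = golden"
  then have "v \<noteq> w" using ico_point_square[OF ico_point_in_ico_points, of v] by auto
  then show "{v, w} \<in> ico_edges"
    using edge_of_icosahedron_if_inner[OF ico_point_in_ico_points ico_point_in_ico_points inner]
    by (auto simp: ico_edges_def)
qed

lemma range_ico_ends: "range ico_ends = ico_edges"
  using type_definition.Rep_range[OF type_definition_ico_edge] .

lemma inj_ico_ends: "inj ico_ends"
  by (simp add: inj_def ico_ends_inject)

lemma card_ico_ends: "card (ico_ends e) = 2"
  using ico_ends[of e] by (auto simp: ico_edges_def)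

text \<open>
  A clique consists of vectors of equal length with equal pairwise inner products. These are
  linearly independent, so there are at most three of them.
\<close>

lemma ico_clique_card:
  assumes "\<And>u v. u \<in> K \<Longrightarrow> v \<in> K \<Longrightarrow> u \<noteq> v \<Longrightarrow> {u, v} \<in> range ico_ends"
  shows "card K \<le> 3"
proof -
  have inner: "ico_point u \<bullet> ico_point v = golden + 2 * of_bool (u = v)"
    if "u \<in> K" "v \<in> K" for u v
    using assms[OF that] ico_point_square[OF ico_point_in_ico_points, of u]
    by (auto simp: range_ico_ends ico_edges_iff)
  have inj: "inj_on ico_point K" by (simp add: inj_on_def ico_point_inject)
  have "independent (ico_point ` K)"
  proof (rule independent_if_scalars_zero)
    fix f x assume "(\<Sum>x\<in>ico_point ` K. f x *\<^sub>R x) = 0" and x: "x \<in> ico_point ` K"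
    then have sum0: "(\<Sum>u\<in>K. f (ico_point u) *\<^sub>R ico_point u) = 0" by (simp add: sum.reindex[OF inj])
    define C where "C = (\<Sum>u\<in>K. f (ico_point u))"
    have each: "golden * C + 2 * f (ico_point v) = 0" if v: "v \<in> K" for v
    proof -
      have "0 = (\<Sum>u\<in>K. f (ico_point u) *\<^sub>R ico_point u) \<bullet> ico_point v" by (simp add: sum0)
      also have "\<dots> = (\<Sum>u\<in>K. f (ico_point u) * (golden + 2 * of_bool (u = v)))"
        using v by (simp add: inner_sum_left inner)
      also have "\<dots> = golden * C + 2 * (\<Sum>u\<in>K. f (ico_point u) * of_bool (u = v))"
        by (simp add: C_def distrib_left sum.distrib sum_distrib_left mult_ac
            del: sum_mult_of_bool_eq sum_of_bool_mult_eq)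
      also have "(\<Sum>u\<in>K. f (ico_point u) * of_bool (u = v)) = f (ico_point v)"
        using v by (simp add: of_bool_def if_distrib sum.delta cong: if_cong
            del: sum_mult_of_bool_eq sum_of_bool_mult_eq)
      finally show ?thesis by simp
    qed
    have "0 = (\<Sum>v\<in>K. golden * C + 2 * f (ico_point v))" using each by simp
    also have "\<dots> = (card K * golden + 2) * C"
      by (simp add: C_def sum.distrib sum_distrib_left[symmetric] algebra_simps)
    finally have "C = 0" using golden_gt_1 by (simp add: add_nonneg_eq_0_iff)
    then show "f x = 0" using each x by auto
  qed simp
  then have "card (ico_point ` K) \<le> DIM(real ^ 3)" by (rule independent_bound[THEN conjunct2])
  then show ?thesis by (simp add: card_image[OF inj])
qed

text \<open>Only the points needed below are shown to be extreme.\<close>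

lemma ico_vertices_exist:
  assumes p: "p \<in> ico_points" and q: "q \<in> ico_points" and pq: "p \<bullet> q = golden"
  shows "p \<in> range ico_point"
proof -
  have "{p} face_of closed_segment p q"
    by (simp add: face_of_singleton extreme_point_of_segment)
  then have "{p} face_of icosahedron"
    using edge_of_icosahedron_if_inner[OF assms] face_of_trans by (auto simp: edge_of_def)
  then have "p extreme_point_of icosahedron" by (simp add: face_of_singleton)
  then show ?thesis by (metis Abs_ico_vertex_inverse mem_Collect_eq rangeI)
qed

text \<open>A vertex and the cycle formed by its five neighbours.\<close>

lemma ico_wheel:
  obtains h :: ico_vertex and r :: "nat \<Rightarrow> ico_vertex" where
    "\<And>i. i < 5 \<Longrightarrow> {h, r i} \<in> range ico_ends"
    "\<And>i. i < 5 \<Longrightarrow> {r i, r (Suc i mod 5)} \<in> range ico_ends"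
proof -
  define P where "P = (\<lambda>i. ico_pt (Suc i))"
  have points: "ico_pt 0 \<in> ico_points" "i < 5 \<Longrightarrow> P i \<in> ico_points" for i
    by (auto simp: P_def ico_points_eq)
  have spoke: "ico_pt 0 \<bullet> P i = golden" if "i < 5" for i
  proof -
    have "i \<in> {0, 1, 2, 3, 4}" using that by auto
    then show ?thesis by (auto simp: P_def ico_pt_coords golden_simps)
  qed
  have rim: "P i \<bullet> P (Suc i mod 5) = golden" if "i < 5" for i
  proof -
    have "i \<in> {0, 1, 2, 3, 4}" using that by auto
    then show ?thesis by (auto simp: P_def ico_pt_coords golden_simps)
  qed
  have "ico_pt 0 \<in> range ico_point"
    using ico_vertices_exist[OF points(1) points(2) spoke] by force
  then obtain h where h: "ico_point h = ico_pt 0" by (metis imageE)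
  have "\<forall>i. \<exists>v. i < 5 \<longrightarrow> ico_point v = P i"
    using ico_vertices_exist[OF points(2) points(1)] spoke by (metis imageE inner_commute)
  then obtain r where r: "\<And>i. i < 5 \<Longrightarrow> ico_point (r i) = P i" by metis
  show thesis
  proof
    show "{h, r i} \<in> range ico_ends" if "i < 5" for i
      using that spoke by (simp add: range_ico_ends ico_edges_iff h r)
    show "{r i, r (Suc i mod 5)} \<in> range ico_ends" if "i < 5" for i
      using that rim by (simp add: range_ico_ends ico_edges_iff r)
  qed
qed

section \<open>Hyperbolicity of the cubic of a graph without 4-cliques\<close>

text \<open>
  The theorem of Motzkin and Straus. If two vertices of the support are not adjacent, the form
  is affine along the shift of weight between them, so one of the two can be emptied without
  loss. This ends with a clique, where the bound is the Cauchy--Schwarz inequality.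
\<close>

lemma motzkin_straus:
  fixes adj :: "'v::finite \<Rightarrow> 'v \<Rightarrow> bool" and w :: "'v \<Rightarrow> real" and k :: nat
  assumes sym: "\<And>u v. adj u v \<Longrightarrow> adj v u" and irrefl: "\<And>v. \<not> adj v v"
    and clique: "\<And>K. (\<And>u v. u \<in> K \<Longrightarrow> v \<in> K \<Longrightarrow> u \<noteq> v \<Longrightarrow> adj u v) \<Longrightarrow> card K \<le> k"
    and nonneg: "\<And>v. 0 \<le> w v"
  shows "k * (\<Sum>u\<in>UNIV. \<Sum>v\<in>UNIV. of_bool (adj u v) * w u * w v)
    \<le> (real k - 1) * (\<Sum>v\<in>UNIV. w v)\<^sup>2"
  using nonneg
proof (induction "card {v. w v \<noteq> 0}" arbitrary: w rule: less_induct)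
  case less
  define S where "S = {v. w v \<noteq> 0}"
  define F where "F = (\<lambda>w :: 'v \<Rightarrow> real. \<Sum>u\<in>UNIV. \<Sum>v\<in>UNIV. of_bool (adj u v) * w u * w v)"
  have outside: "w v = 0" if "v \<notin> S" for v using that by (simp add: S_def)
  show ?case
  proof (cases "\<forall>u\<in>S. \<forall>v\<in>S. u \<noteq> v \<longrightarrow> adj u v")
    case True
    then have card: "card S \<le> k" by (intro clique) auto
    have sum_S: "(\<Sum>v\<in>UNIV. w v) = (\<Sum>v\<in>S. w v)" "(\<Sum>v\<in>UNIV. (w v)\<^sup>2) = (\<Sum>v\<in>S. (w v)\<^sup>2)"
      by (rule sum.mono_neutral_right; simp add: outside)+
    have "of_bool (adj u v) * w u * w v \<le> w u * w v - of_bool (u = v) * (w u)\<^sup>2" for u v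
      using irrefl less.prems[of u] less.prems[of v] by (auto simp: power2_eq_square)
    then have "F w \<le> (\<Sum>u\<in>UNIV. \<Sum>v\<in>UNIV. w u * w v - of_bool (u = v) * (w u)\<^sup>2)"
      unfolding F_def by (intro sum_mono)
    also have "\<dots> = (\<Sum>v\<in>UNIV. w v)\<^sup>2 - (\<Sum>v\<in>UNIV. (w v)\<^sup>2)"
    proof -
      have "(\<Sum>v\<in>UNIV. of_bool (u = v) * (w u)\<^sup>2) = (w u)\<^sup>2" for u by simp
      then show ?thesis
        unfolding sum_subtractf by (simp add: sum_product power2_eq_square[of "sum w UNIV"])
    qed
    finally have F: "F w \<le> (\<Sum>v\<in>UNIV. w v)\<^sup>2 - (\<Sum>v\<in>UNIV. (w v)\<^sup>2)" .
    have "(\<Sum>v\<in>S. w v)\<^sup>2 \<le> card S * (\<Sum>v\<in>S. (w v)\<^sup>2)"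
      using Cauchy_Schwarz_ineq_sum[of "\<lambda>_. 1" w S] by simp
    also have "\<dots> \<le> k * (\<Sum>v\<in>S. (w v)\<^sup>2)"
      using card by (intro mult_right_mono) (auto intro: sum_nonneg)
    finally have "k * F w \<le> (real k - 1) * (\<Sum>v\<in>UNIV. w v)\<^sup>2"
      using mult_left_mono[OF F, of k] unfolding sum_S by (simp add: algebra_simps)
    then show ?thesis by (simp add: F_def)
  next
    case False
    define d where "d = (\<lambda>u. \<Sum>v\<in>UNIV. of_bool (adj u v) * w v)"
    from False have "\<exists>u v. u \<in> S \<and> v \<in> S \<and> u \<noteq> v \<and> \<not> adj u v \<and> d v \<le> d u"
      using sym by (metis linorder_linear)
    then obtain u v where uv: "u \<in> S" "v \<in> S" "u \<noteq> v" "\<not> adj u v" "d v \<le> d u" by blast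
    define \<delta> where "\<delta> = (\<lambda>a. of_bool (a = u) - of_bool (a = v) :: real)"
    define w' where "w' = (\<lambda>a. w a + w v * \<delta> a)"
    have "{a. w' a \<noteq> 0} \<subseteq> S - {v}"
      using uv by (auto simp: w'_def \<delta>_def S_def)
    then have "card {a. w' a \<noteq> 0} < card S"
      using uv(2) by (metis card_Diff1_less card_mono finite le_less_trans)
    moreover have "0 \<le> w' a" for a
      using less.prems[of a] less.prems[of v] by (auto simp: w'_def \<delta>_def)
    ultimately have IH: "k * F w' \<le> (real k - 1) * (\<Sum>a\<in>UNIV. w' a)\<^sup>2"
      unfolding F_def S_def using less.hyps by blast
    have pick: "(\<Sum>a\<in>UNIV. \<delta> a * h a) = h u - h v" for h
      by (simp add: \<delta>_def left_diff_distrib sum_subtractf)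
    have same: "(\<Sum>a\<in>UNIV. w' a) = (\<Sum>a\<in>UNIV. w a)"
      using pick[of "\<lambda>_. 1"] by (simp add: w'_def sum.distrib sum_distrib_left[symmetric])
    have adj_sym: "of_bool (adj a b) = (of_bool (adj b a) :: real)" for a b
      using sym[of a b] sym[of b a] by auto
    have row: "(\<Sum>b\<in>UNIV. of_bool (adj a b) * w' b)
        = d a + w v * (of_bool (adj a u) - of_bool (adj a v))" for a
      using pick[of "\<lambda>b. w v * of_bool (adj a b)"]
      by (simp add: w'_def d_def distrib_left sum.distrib right_diff_distrib mult_ac)
    have "F w' = (\<Sum>a\<in>UNIV. w' a * (\<Sum>b\<in>UNIV. of_bool (adj a b) * w' b))"
      by (simp add: F_def sum_distrib_left mult_ac del: sum_mult_of_bool_eq sum_of_bool_mult_eq)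
    also have "\<dots> = (\<Sum>a\<in>UNIV. w a * (d a + w v * (of_bool (adj a u) - of_bool (adj a v))))
        + w v * (\<Sum>a\<in>UNIV. \<delta> a * (d a + w v * (of_bool (adj a u) - of_bool (adj a v))))"
      unfolding row by (simp add: w'_def distrib_right sum.distrib sum_distrib_left mult_ac)
    also have "(\<Sum>a\<in>UNIV. \<delta> a * (d a + w v * (of_bool (adj a u) - of_bool (adj a v))))
        = d u - d v"
      unfolding pick using uv irrefl sym by auto
    also have "(\<Sum>a\<in>UNIV. w a * (d a + w v * (of_bool (adj a u) - of_bool (adj a v))))
        = F w + w v * (d u - d v)"
      by (simp add: F_def d_def adj_sym[of _ u] adj_sym[of _ v] algebra_simps sum.distrib
          sum_subtractf sum_distrib_left del: sum_mult_of_bool_eq sum_of_bool_mult_eq)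
    finally have "F w' = F w + 2 * w v * (d u - d v)" by simp
    then have "F w \<le> F w'" using uv less.prems[of v] by simp
    then have "k * F w \<le> k * F w'" by (intro mult_left_mono) auto
    then show ?thesis using IH unfolding same F_def by linarith
  qed
qed

lemma sum_over_edges:
  fixes E :: "'e::finite \<Rightarrow> 'v::finite set" and w :: "'v \<Rightarrow> real"
  assumes inj: "inj E" and card: "\<And>e. card (E e) = 2"
  shows "2 * (\<Sum>e\<in>UNIV. \<Prod>i\<in>E e. w i)
    = (\<Sum>u\<in>UNIV. \<Sum>v\<in>UNIV. of_bool ({u, v} \<in> range E) * w u * w v)"
proof -
  let ?A = "{x. {fst x, snd x} \<in> range E}"
  have fibre: "(\<Sum>x\<in>{x \<in> ?A. {fst x, snd x} = E e}. w (fst x) * w (snd x))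
      = 2 * (\<Prod>i\<in>E e. w i)" for e
  proof -
    obtain a b where ab: "E e = {a, b}" "a \<noteq> b" using card[of e] by (auto simp: card_2_iff)
    have "{x \<in> ?A. {fst x, snd x} = E e} = {x. {fst x, snd x} = E e}"
      by (metis (mono_tags, lifting) Collect_cong mem_Collect_eq rangeI)
    also have "\<dots> = {(a, b), (b, a)}"
      unfolding ab(1) by (auto simp: doubleton_eq_iff)
    finally have "{x \<in> ?A. {fst x, snd x} = E e} = {(a, b), (b, a)}" .
    then show ?thesis using ab by simp
  qed
  have "2 * (\<Sum>e\<in>UNIV. \<Prod>i\<in>E e. w i)
      = (\<Sum>e\<in>UNIV. \<Sum>x\<in>{x \<in> ?A. {fst x, snd x} = E e}. w (fst x) * w (snd x))"
    unfolding fibre by (rule sum_distrib_left)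
  also have "\<dots> = (\<Sum>s\<in>range E. \<Sum>x\<in>{x \<in> ?A. {fst x, snd x} = s}. w (fst x) * w (snd x))"
    using inj by (simp add: sum.reindex)
  also have "\<dots> = (\<Sum>x\<in>?A. w (fst x) * w (snd x))"
    by (rule sum.group) auto
  also have "\<dots> = (\<Sum>x\<in>UNIV. of_bool ({fst x, snd x} \<in> range E) * w (fst x) * w (snd x))"
    by (rule sum.mono_neutral_cong_left) auto
  also have "\<dots> = (\<Sum>u\<in>UNIV. \<Sum>v\<in>UNIV. of_bool ({u, v} \<in> range E) * w u * w v)"
    unfolding sum.cartesian_product UNIV_Times_UNIV by (simp add: case_prod_beta)
  finally show ?thesis .
qed

text \<open>
  The cubic of a graph is \<open>x\<^sub>0\<^sup>3 - 3 x\<^sub>0 \<parallel>z\<parallel>\<^sup>2 + 2 q(z)\<close>, where \<open>q\<close> is the following form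
  in \<open>z = (x, y)\<close>.
\<close>

definition edge_form ::
  "('e::finite \<Rightarrow> 'v::finite set) \<Rightarrow> (real ^ 'v) \<times> (real ^ 'e) \<Rightarrow> real" where
  "edge_form E z = 9 / 2 * (\<Sum>e\<in>UNIV. (\<Prod>i\<in>E e. fst z $ i) * snd z $ e)"

lemma graph_cubic_eq:
  "graph_cubic E (x0, z) = x0 ^ 3 - 3 * x0 * (norm z)\<^sup>2 + 2 * edge_form E z"
  by (cases z) (simp add: graph_cubic_def edge_form_def norm_Pair)

lemma edge_form_scaleR:
  assumes "\<And>e. card (E e) = 2"
  shows "edge_form E (c *\<^sub>R z) = c ^ 3 * edge_form E z"
  by (simp add: edge_form_def prod.distrib assms sum_distrib_left power2_eq_square
      power3_eq_cube mult_ac)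

lemma homogeneous_graph_cubic:
  assumes "\<And>e. card (E e) = 2"
  shows "homogeneous_poly 3 (graph_cubic E)"
proof -
  have lin: "real_polynomial_function f" if "bounded_linear f"
    for f :: "real \<times> (real ^ 'b) \<times> (real ^ 'a) \<Rightarrow> real"
    using that by (rule real_polynomial_function.intros)
  have coords: "real_polynomial_function (fst :: real \<times> (real ^ 'b) \<times> (real ^ 'a) \<Rightarrow> real)"
    "real_polynomial_function (\<lambda>z :: real \<times> (real ^ 'b) \<times> (real ^ 'a). fst (snd z) $ i)"
    "real_polynomial_function (\<lambda>z :: real \<times> (real ^ 'b) \<times> (real ^ 'a). snd (snd z) $ e)" for i e
    by (intro lin bounded_linear_fst bounded_linear_compose[OF bounded_linear_vec_nth]
        bounded_linear_compose[OF bounded_linear_fst bounded_linear_snd]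
        bounded_linear_compose[OF bounded_linear_snd bounded_linear_snd])+
  have eq: "graph_cubic E = (\<lambda>z. fst z ^ 3 - 3 * fst z * ((\<Sum>i\<in>UNIV. (fst (snd z) $ i)\<^sup>2)
      + (\<Sum>e\<in>UNIV. (snd (snd z) $ e)\<^sup>2))
      + 9 * (\<Sum>e\<in>UNIV. (\<Prod>i\<in>E e. fst (snd z) $ i) * snd (snd z) $ e))"
    by (auto simp: graph_cubic_def norm_vec_def L2_set_def sum_nonneg)
  have "real_polynomial_function (graph_cubic E)"
    unfolding eq by (intro coords real_polynomial_function.intros(2-4) real_polynomial_function_diff
        real_polynomial_function_power real_polynomial_function_sum real_polynomial_function_prod
        finite)
  moreover have "graph_cubic E (c *\<^sub>R z) = c ^ 3 * graph_cubic E z" for c z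
  proof -
    obtain x0 w where z: "z = (x0, w)" by (cases z)
    have "c *\<^sub>R z = (c * x0, c *\<^sub>R w)" by (simp add: z)
    then show ?thesis
      unfolding z by (simp only: graph_cubic_eq edge_form_scaleR[of E, OF assms] norm_scaleR
          power_mult_distrib power2_abs) (simp add: algebra_simps power2_eq_square power3_eq_cube)
  qed
  ultimately show ?thesis by (simp add: homogeneous_poly_def)
qed

lemma edge_form_bound:
  fixes E :: "'e::finite \<Rightarrow> 'v::finite set"
  assumes inj: "inj E" and card: "\<And>e. card (E e) = 2"
    and clique: "\<And>K. (\<And>u v. u \<in> K \<Longrightarrow> v \<in> K \<Longrightarrow> u \<noteq> v \<Longrightarrow> {u, v} \<in> range E) \<Longrightarrow> card K \<le> 3"
  shows "(edge_form E z)\<^sup>2 \<le> ((norm z)\<^sup>2) ^ 3"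
proof -
  define X Y where "X = (norm (fst z))\<^sup>2" and "Y = (norm (snd z))\<^sup>2"
  have nonneg: "X \<ge> 0" "Y \<ge> 0" by (simp_all add: X_def Y_def)
  have X: "X = (\<Sum>i\<in>UNIV. (fst z $ i)\<^sup>2)" and Y: "Y = (\<Sum>e\<in>UNIV. (snd z $ e)\<^sup>2)"
    by (simp_all add: X_def Y_def norm_vec_def L2_set_def sum_nonneg)
  have no_loop: "{v, v} \<notin> range E" for v
  proof
    assume "{v, v} \<in> range E"
    then obtain e where "E e = {v}" by auto
    then show False using card[of e] by simp
  qed
  have "3 * (\<Sum>u\<in>UNIV. \<Sum>v\<in>UNIV. of_bool ({u, v} \<in> range E) * (fst z $ u)\<^sup>2 * (fst z $ v)\<^sup>2)
      \<le> 2 * X\<^sup>2"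
    using motzkin_straus[of "\<lambda>u v. {u, v} \<in> range E" 3 "\<lambda>i. (fst z $ i)\<^sup>2"] no_loop clique
    by (simp add: X insert_commute)
  then have MS: "3 * (\<Sum>e\<in>UNIV. (\<Prod>i\<in>E e. fst z $ i)\<^sup>2) \<le> X\<^sup>2"
    using sum_over_edges[OF inj card, of "\<lambda>i. (fst z $ i)\<^sup>2"] by (simp add: prod_power_distrib)
  have "(\<Sum>e\<in>UNIV. (\<Prod>i\<in>E e. fst z $ i) * snd z $ e)\<^sup>2
      \<le> (\<Sum>e\<in>UNIV. (\<Prod>i\<in>E e. fst z $ i)\<^sup>2) * Y"
    unfolding Y by (rule Cauchy_Schwarz_ineq_sum)
  also have "\<dots> \<le> X\<^sup>2 / 3 * Y"
    using MS nonneg by (intro mult_right_mono) auto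
  finally have "(edge_form E z)\<^sup>2 \<le> 27 / 4 * (X\<^sup>2 * Y)"
    by (simp add: edge_form_def power_mult_distrib power2_eq_square)
  moreover have "0 \<le> (X - 2 * Y)\<^sup>2 * (4 * X + Y)" using nonneg by simp
  moreover have "(X - 2 * Y)\<^sup>2 * (4 * X + Y) = 4 * (X + Y) ^ 3 - 27 * (X\<^sup>2 * Y)"
    by (simp add: power2_eq_square power3_eq_cube algebra_simps)
  ultimately have "(edge_form E z)\<^sup>2 \<le> (X + Y) ^ 3" by linarith
  moreover have "(norm z)\<^sup>2 = X + Y" by (cases z) (simp add: X_def Y_def norm_Pair)
  ultimately show ?thesis by simp
qed

lemma depressed_cubic_real_roots:
  fixes N q :: real and z :: complex
  assumes "N \<ge> 0" and disc: "q\<^sup>2 \<le> N ^ 3"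
    and root: "z ^ 3 - 3 * of_real N * z + 2 * of_real q = 0"
  shows "z \<in> \<real>"
proof (rule ccontr)
  define a b where "a = Re z" and "b = Im z"
  assume "z \<notin> \<real>"
  then have b: "b \<noteq> 0" by (simp add: b_def complex_is_Real_iff)
  have z: "z = Complex a b" by (simp add: a_def b_def)
  have "b * (3 * a\<^sup>2 - b\<^sup>2 - 3 * N) = 0"
    using arg_cong[OF root, of Im] by (simp add: z power2_eq_square power3_eq_cube algebra_simps)
  then have b2: "b\<^sup>2 = 3 * a\<^sup>2 - 3 * N" using b by simp
  have "a ^ 3 - 3 * a * b\<^sup>2 - 3 * N * a + 2 * q = 0"
    using arg_cong[OF root, of Re] by (simp add: z power2_eq_square power3_eq_cube algebra_simps)
  then have q: "q = 4 * a ^ 3 - 3 * N * a"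
    unfolding b2 by (simp add: algebra_simps power2_eq_square power3_eq_cube)
  have "q\<^sup>2 = N ^ 3 + (a\<^sup>2 - N) * (4 * a\<^sup>2 - N)\<^sup>2"
    unfolding q by (simp add: algebra_simps power2_eq_square power3_eq_cube)
  moreover have gt: "a\<^sup>2 > N" using b2 b by (smt (verit) zero_less_power2)
  ultimately have "(4 * a\<^sup>2 - N)\<^sup>2 \<le> 0"
    using disc by (smt (verit) mult_pos_pos zero_le_power2)
  then show False using gt assms(1) by simp
qed

lemma graph_cubic_hyperbolic:
  fixes E :: "'e::finite \<Rightarrow> 'v::finite set"
  assumes inj: "inj E" and card: "\<And>e. card (E e) = 2"
    and clique: "\<And>K. (\<And>u v. u \<in> K \<Longrightarrow> v \<in> K \<Longrightarrow> u \<noteq> v \<Longrightarrow> {u, v} \<in> range E) \<Longrightarrow> card K \<le> 3"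
  shows "hyperbolic 3 (graph_cubic E) (1, 0, 0)"
proof -
  have polynomial: "real_polynomial_function (graph_cubic E)"
    using homogeneous_graph_cubic[of E, OF card] by (simp add: homogeneous_poly_def)
  have real: "w \<in> \<real>"
    if root: "poly (map_poly complex_of_real (line_poly (graph_cubic E) x (1, 0, 0))) w = 0" for x w
  proof -
    obtain x0 z where x: "x = (x0, z)" by (cases x)
    define N q where "N = (norm z)\<^sup>2" and "q = edge_form E z"
    have line: "x + t *\<^sub>R (1, 0, 0) = (x0 + t, z)" for t
      by (simp add: x plus_prod_def zero_prod_def[symmetric])
    have "poly (line_poly (graph_cubic E) x (1, 0, 0)) t
        = poly [:x0 ^ 3 - 3 * x0 * N + 2 * q, 3 * x0\<^sup>2 - 3 * N, 3 * x0, 1:] t" for t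
      unfolding poly_line_poly[OF polynomial] line graph_cubic_eq N_def[symmetric] q_def[symmetric]
      by (simp add: power2_eq_square power3_eq_cube algebra_simps)
    then have "line_poly (graph_cubic E) x (1, 0, 0)
        = [:x0 ^ 3 - 3 * x0 * N + 2 * q, 3 * x0\<^sup>2 - 3 * N, 3 * x0, 1:]"
      by (simp add: poly_eq_poly_eq_iff[symmetric] ext del: poly_pCons)
    then have "(of_real x0 + w) ^ 3 - 3 * of_real N * (of_real x0 + w) + 2 * of_real q = 0"
      using root by (simp add: map_poly_pCons power2_eq_square power3_eq_cube algebra_simps)
    then have "of_real x0 + w \<in> \<real>"
      using edge_form_bound[OF assms, of z]
      by (intro depressed_cubic_real_roots[of N q]) (simp_all add: N_def q_def)
    then show ?thesis by (simp add: complex_is_Real_iff)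
  qed
  show ?thesis
    using homogeneous_graph_cubic[of E, OF card] real
    by (simp add: hyperbolic_def graph_cubic_def)
qed

section \<open>Polynomial functions of bounded growth\<close>

text \<open>
  The sums of squares bound the polynomials \<open>l\<^sub>k\<close> by the norm and \<open>f\<^sub>k\<close> by its square. These bounds
  limit the degrees on lines, and thereby make \<open>l\<^sub>k\<close> linear and \<open>f\<^sub>k\<close> quadratic forms.
\<close>

lemma bounded_poly_degree_0:
  fixes p :: "real poly"
  assumes "\<And>t. t \<ge> 1 \<Longrightarrow> \<bar>poly p t\<bar> \<le> K"
  shows "degree p = 0"
proof (rule ccontr)
  assume deg: "degree p \<noteq> 0"
  have "\<exists>q :: real poly. degree q \<noteq> 0 \<and> lead_coeff q > 0 \<and> (\<forall>t\<ge>1. \<bar>poly q t\<bar> \<le> K)"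
  proof (cases "lead_coeff p > 0")
    case False
    then have "lead_coeff (- p) > 0"
      using deg by (metis coeff_minus degree_0 degree_minus leading_coeff_0_iff linorder_cases
          neg_0_less_iff_less)
    then show ?thesis using deg assms by (intro exI[of _ "- p"]) auto
  qed (use deg assms in auto)
  then obtain q :: "real poly" where q: "degree q \<noteq> 0" "lead_coeff q > 0"
    and bound: "\<And>t. t \<ge> 1 \<Longrightarrow> \<bar>poly q t\<bar> \<le> K" by blast
  have deg': "degree (q - [:K:]) = degree q"
    using q(1) degree_add_eq_left[of "[:- K:]" q] by (simp add: diff_conv_add_uminus)
  have "lead_coeff (q - [:K:]) > 0"
    using q by (cases "degree q") (simp_all add: deg')
  then obtain n where n: "\<And>t. t \<ge> n \<Longrightarrow> poly (q - [:K:]) t \<ge> lead_coeff (q - [:K:])"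
    using poly_pinfty_gt_lc by blast
  show False
    using n[of "max n 1"] bound[of "max n 1"] \<open>lead_coeff (q - [:K:]) > 0\<close> by auto
qed

text \<open>Along each line, a polynomial function of linear growth is affine.\<close>

lemma linear_growth_on_line:
  fixes g :: "'a::euclidean_space \<Rightarrow> real"
  assumes "real_polynomial_function g" and bound: "\<And>x. \<bar>g x\<bar> \<le> norm x"
  obtains c d where "\<And>t. g (a + t *\<^sub>R b) = c + d * t"
proof -
  obtain c r where P: "line_poly g a b = pCons c r" by (cases "line_poly g a b")
  have eq: "g (a + t *\<^sub>R b) = c + t * poly r t" for t
    using poly_line_poly[OF assms(1), of a b t] by (simp add: P)
  have "\<bar>poly r t\<bar> \<le> norm a + norm b + \<bar>c\<bar>" if t: "t \<ge> 1" for t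
  proof -
    have "\<bar>t * poly r t\<bar> \<le> \<bar>c\<bar> + \<bar>g (a + t *\<^sub>R b)\<bar>" using eq[of t] by linarith
    also have "\<bar>g (a + t *\<^sub>R b)\<bar> \<le> norm a + t * norm b"
      using bound[of "a + t *\<^sub>R b"] norm_triangle_ineq[of a "t *\<^sub>R b"] t by simp
    also have "\<bar>c\<bar> + (norm a + t * norm b) \<le> t * (norm a + norm b + \<bar>c\<bar>)"
      using mult_right_mono[OF t, of "norm a"] mult_right_mono[OF t, of "\<bar>c\<bar>"]
      by (simp add: algebra_simps)
    finally show ?thesis using t by (simp add: abs_mult)
  qed
  then have "degree r = 0" by (rule bounded_poly_degree_0)
  then obtain d where "r = [:d:]" by (rule degree_eq_zeroE)
  then show thesis using that[of c d] eq by simp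
qed

lemma linear_if_linear_growth:
  fixes g :: "'a::euclidean_space \<Rightarrow> real"
  assumes g: "real_polynomial_function g" and bound: "\<And>x. \<bar>g x\<bar> \<le> norm x"
  shows "linear g"
proof -
  have g0: "g 0 = 0" using bound[of 0] by simp
  have scale: "g (t *\<^sub>R b) = t * g b" for t b
  proof -
    obtain c d where cd: "\<And>t. g (0 + t *\<^sub>R b) = c + d * t"
      using linear_growth_on_line[OF g bound] by blast
    show ?thesis using cd[of 0] cd[of 1] cd[of t] g0 by simp
  qed
  have "g (a + b) = g a + g b" for a b
  proof -
    obtain c d where cd: "\<And>t. g (a + t *\<^sub>R b) = c + d * t"
      using linear_growth_on_line[OF g bound] by blast
    obtain c' d' where cd': "\<And>t. g (b + t *\<^sub>R a) = c' + d' * t"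
      using linear_growth_on_line[OF g bound] by blast
    \<comment> \<open>By homogeneity, the lines through \<open>a\<close> and \<open>b\<close> with exchanged roles carry the same
      coefficients in reverse order.\<close>
    have rev: "c + d * t = t * (c' + d' * (1 / t))" if "t \<noteq> 0" for t
    proof -
      have "a + t *\<^sub>R b = t *\<^sub>R (b + (1 / t) *\<^sub>R a)" using that by (simp add: scaleR_add_right)
      then have "g (a + t *\<^sub>R b) = g (t *\<^sub>R (b + (1 / t) *\<^sub>R a))" by simp
      then show ?thesis unfolding scale cd cd' .
    qed
    have "d = c'" using rev[of 1] rev[of 2] by simp
    then show ?thesis using cd[of 0] cd[of 1] cd'[of 0] by simp
  qed
  then show ?thesis using scale by (auto intro!: linearI)
qed

lemma quadratic_growth_on_line:
  fixes g :: "'a::euclidean_space \<Rightarrow> real"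
  assumes "real_polynomial_function g" and bound: "\<And>x. \<bar>g x\<bar> \<le> (norm x)\<^sup>2"
  obtains c d e where "\<And>t. g (a + t *\<^sub>R b) = c + d * t + e * t\<^sup>2"
proof -
  obtain c r' where P: "line_poly g a b = pCons c r'" by (cases "line_poly g a b")
  obtain d r where P': "r' = pCons d r" by (cases r')
  have eq: "g (a + t *\<^sub>R b) = c + d * t + t\<^sup>2 * poly r t" for t
    using poly_line_poly[OF assms(1), of a b t]
    by (simp add: P P' algebra_simps power2_eq_square)
  have "\<bar>poly r t\<bar> \<le> (norm a + norm b)\<^sup>2 + \<bar>c\<bar> + \<bar>d\<bar>" if t: "t \<ge> 1" for t
  proof -
    have t2: "1 \<le> t\<^sup>2" "t \<le> t\<^sup>2" using t by (simp_all add: self_le_power)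
    have "\<bar>t\<^sup>2 * poly r t\<bar> \<le> \<bar>c\<bar> + \<bar>d\<bar> * t + \<bar>g (a + t *\<^sub>R b)\<bar>"
      using eq[of t] abs_mult[of d t] t by linarith
    moreover have "\<bar>g (a + t *\<^sub>R b)\<bar> \<le> t\<^sup>2 * (norm a + norm b)\<^sup>2"
    proof -
      have "norm (a + t *\<^sub>R b) \<le> norm a + t * norm b"
        using norm_triangle_ineq[of a "t *\<^sub>R b"] t by simp
      also have "\<dots> \<le> t * (norm a + norm b)"
        using mult_right_mono[OF t, of "norm a"] by (simp add: algebra_simps)
      finally show ?thesis
        using bound[of "a + t *\<^sub>R b"] power_mono[of "norm (a + t *\<^sub>R b)" "t * (norm a + norm b)" 2]
        by (simp add: power_mult_distrib)
    qed
    moreover have "\<bar>c\<bar> + \<bar>d\<bar> * t \<le> t\<^sup>2 * (\<bar>c\<bar> + \<bar>d\<bar>)"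
      using mult_right_mono[OF t2(1), of "\<bar>c\<bar>"] mult_right_mono[OF t2(2), of "\<bar>d\<bar>"]
      by (simp add: algebra_simps)
    ultimately have "t\<^sup>2 * \<bar>poly r t\<bar> \<le> t\<^sup>2 * ((norm a + norm b)\<^sup>2 + \<bar>c\<bar> + \<bar>d\<bar>)"
      by (simp add: abs_mult algebra_simps)
    then show ?thesis using t by simp
  qed
  then have "degree r = 0" by (rule bounded_poly_degree_0)
  then obtain e where "r = [:e:]" by (rule degree_eq_zeroE)
  then show thesis using that[of c d e] eq by (simp add: algebra_simps)
qed

text \<open>
  The behaviour on lines gives homogeneity and the parallelogram law, and the latter gives additivity
  of the polarization, as in the theorem of Jordan and von Neumann.
\<close>

lemma bilinear_if_quadratic_growth:
  fixes g :: "'a::euclidean_space \<Rightarrow> real"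
  assumes g: "real_polynomial_function g" and bound: "\<And>x. \<bar>g x\<bar> \<le> (norm x)\<^sup>2"
  obtains B where "bilinear B" "\<And>a b. B a b = B b a" "\<And>a. g a = B a a"
proof -
  have g0: "g 0 = 0" using bound[of 0] by simp
  have scale: "g (t *\<^sub>R b) = t\<^sup>2 * g b" for t b
  proof -
    obtain c d e where cde: "\<And>t. g (0 + t *\<^sub>R b) = c + d * t + e * t\<^sup>2"
      using quadratic_growth_on_line[OF g bound] by blast
    have e: "g (t *\<^sub>R b) = d * t + e * t\<^sup>2" for t
      using cde[of t] cde[of 0] g0 by simp
    have "d = 0"
    proof (rule ccontr)
      assume d: "d \<noteq> 0"
      \<comment> \<open>For small \<open>s\<close> the linear term outgrows the quadratic bound.\<close>
      define K where "K = (norm b)\<^sup>2 + \<bar>e\<bar> + 1"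
      define s where "s = \<bar>d\<bar> / K"
      have K: "K > 0" by (simp add: K_def add_nonneg_pos)
      then have s: "s > 0" using d by (simp add: s_def)
      have *: "\<bar>d * s + e * s\<^sup>2\<bar> \<le> s\<^sup>2 * (norm b)\<^sup>2"
        using bound[of "s *\<^sub>R b"] by (simp add: e power_mult_distrib)
      have "\<bar>d\<bar> * s \<le> s\<^sup>2 * (norm b)\<^sup>2 + \<bar>e\<bar> * s\<^sup>2"
      proof -
        have "\<bar>d\<bar> * s = \<bar>d * s\<bar>" "\<bar>e\<bar> * s\<^sup>2 = \<bar>e * s\<^sup>2\<bar>" using s by (simp_all add: abs_mult)
        then show ?thesis using * by linarith
      qed
      also have "\<dots> < s * (s * K)"
        using s by (simp add: K_def algebra_simps power2_eq_square)
      finally show False using s K by (simp add: s_def)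
    qed
    then show ?thesis using e[of t] e[of 1] by simp
  qed
  have line: "g (a + t *\<^sub>R b) = g a + (g (a + b) - g a - g b) * t + g b * t\<^sup>2" for a b t
  proof -
    obtain c d e where cd: "\<And>t. g (a + t *\<^sub>R b) = c + d * t + e * t\<^sup>2"
      using quadratic_growth_on_line[OF g bound] by blast
    obtain c' d' e' where cd': "\<And>t. g (b + t *\<^sub>R a) = c' + d' * t + e' * t\<^sup>2"
      using quadratic_growth_on_line[OF g bound] by blast
    have rev: "c + d * t + e * t\<^sup>2 = t\<^sup>2 * (c' + d' * (1 / t) + e' * (1 / t)\<^sup>2)" if "t \<noteq> 0" for t
    proof -
      have "a + t *\<^sub>R b = t *\<^sub>R (b + (1 / t) *\<^sub>R a)" using that by (simp add: scaleR_add_right)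
      then have "g (a + t *\<^sub>R b) = g (t *\<^sub>R (b + (1 / t) *\<^sub>R a))" by simp
      then show ?thesis unfolding scale cd cd' .
    qed
    have "e = c'" using rev[of 1] rev[of 2] rev[of "-1"] by (simp add: power2_eq_square field_simps)
    moreover have "c = g a" "c' = g b" using cd[of 0] cd'[of 0] by simp_all
    moreover have "g (a + b) = c + d + e" using cd[of 1] by simp
    ultimately show ?thesis using cd[of t] by simp
  qed
  have parallelogram: "g (a + b) + g (a - b) = 2 * g a + 2 * g b" for a b
    using line[of a "-1" b] by simp
  define B where "B = (\<lambda>a b. (g (a + b) - g a - g b) / 2)"
  have sym: "B a b = B b a" for a b by (simp add: B_def add.commute)
  have B_scale: "B a (t *\<^sub>R b) = t * B a b" for a b t
    by (simp add: B_def line scale algebra_simps)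
  have B_add: "B a (b + c) = B a b + B a c" for a b c
  proof -
    have shift: "a - (b - c) = a + c - b" "a + (b - c) = a + b - c" "a + c + b = a + b + c"
      by (simp_all add: algebra_simps)
    have "g (a + b + c) = g (a + b) + g (a + c) + g (b + c) - g a - g b - g c"
      using parallelogram[of "a + b" c] parallelogram[of a "b - c", unfolded shift]
        parallelogram[of "a + c" b, unfolded shift] parallelogram[of b c] by linarith
    then show ?thesis by (simp add: B_def add.assoc field_simps)
  qed
  have "linear (B a)" for a
    by (rule linearI) (simp_all add: B_add B_scale)
  then have "bilinear B"
    unfolding bilinear_def by (simp add: sym[of _ b for b])
  moreover have "g a = B a a" for a
    using scale[of 2 a] by (simp add: B_def scaleR_2)
  ultimately show thesis using that sym by blast
qed

section \<open>The Bezoutian in the direction of the first basis vector\<close>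

lemma bezoutian_coefficients_unique:
  fixes A B :: "nat \<Rightarrow> nat \<Rightarrow> real"
  assumes eq: "\<And>t s. t \<noteq> s \<Longrightarrow>
    (\<Sum>i<d. \<Sum>j<d. A i j * t ^ i * s ^ j) = (\<Sum>i<d. \<Sum>j<d. B i j * t ^ i * s ^ j)"
    and ij: "i < d" "j < d"
  shows "A i j = B i j"
proof -
  have coeffs: "(\<forall>i<d. a i = b i)"
    if "infinite T" "\<And>t. t \<in> T \<Longrightarrow> (\<Sum>i<d. a i * t ^ i) = (\<Sum>i<d. b i * t ^ i)"
    for a b :: "nat \<Rightarrow> real" and T :: "real set"
  proof -
    define p where "p = (\<Sum>i<d. monom (a i - b i) i)"
    have "T \<subseteq> {t. poly p t = 0}"
      using that(2) by (auto simp: p_def poly_sum poly_monom left_diff_distrib sum_subtractf)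
    then have "infinite {t. poly p t = 0}" using that(1) by (rule infinite_super)
    then have "p = 0" using poly_roots_finite[of p] by argo
    then have "coeff p i = 0" for i by simp
    then have "(if i < d then a i - b i else 0) = 0" for i by (simp add: p_def coeff_sum)
    then show ?thesis by (metis eq_iff_diff_eq_0)
  qed
  have "(\<Sum>i<d. A i j * t ^ i) = (\<Sum>i<d. B i j * t ^ i)" for t
  proof -
    have "infinite (- {t})" by (simp add: Compl_eq_Diff_UNIV infinite_UNIV_char_0)
    moreover have "(\<Sum>j<d. (\<Sum>i<d. A i j * t ^ i) * s ^ j) = (\<Sum>j<d. (\<Sum>i<d. B i j * t ^ i) * s ^ j)"
      if "s \<in> - {t}" for s
    proof -
      have "(\<Sum>j<d. (\<Sum>i<d. C i j * t ^ i) * s ^ j) = (\<Sum>i<d. \<Sum>j<d. C i j * t ^ i * s ^ j)"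
        for C :: "nat \<Rightarrow> nat \<Rightarrow> real"
        unfolding sum_distrib_right by (rule sum.swap)
      then show ?thesis using eq[of t s] that by simp
    qed
    ultimately show ?thesis
      using coeffs[of "- {t}" "\<lambda>j. \<Sum>i<d. A i j * t ^ i" "\<lambda>j. \<Sum>i<d. B i j * t ^ i"] ij(2)
      by simp
  qed
  then show ?thesis
    using coeffs[of UNIV "\<lambda>i. A i j" "\<lambda>i. B i j"] ij(1) by (simp add: infinite_UNIV_char_0)
qed

lemma dir_deriv_graph_cubic:
  "dir_deriv (1, 0, 0) (graph_cubic E) (x0, z) = 3 * x0\<^sup>2 - 3 * (norm z)\<^sup>2"
proof -
  have "(x0, z) + r *\<^sub>R (1, 0, 0) = (x0 + r, z)" for r
    by (simp add: plus_prod_def zero_prod_def[symmetric])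
  then have "dir_deriv (1, 0, 0) (graph_cubic E) (x0, z)
      = deriv (\<lambda>r. (x0 + r) ^ 3 - 3 * (x0 + r) * (norm z)\<^sup>2 + 2 * edge_form E z) 0"
    by (simp only: dir_deriv_def graph_cubic_eq)
  also have "\<dots> = 3 * x0\<^sup>2 - 3 * (norm z)\<^sup>2"
    by (rule DERIV_imp_deriv) (auto intro!: derivative_eq_intros)
  finally show ?thesis .
qed

lemma bezoutian_graph_cubic:
  fixes E :: "'e::finite \<Rightarrow> 'v::finite set" and z :: "(real ^ 'v) \<times> (real ^ 'e)"
  defines "N \<equiv> (norm z)\<^sup>2" and "q \<equiv> edge_form E z"
  shows "bezoutian 3 (graph_cubic E) (1, 0, 0) (0, z) (1, 0, 0)
    = mat 3 3 (\<lambda>(i, j). [[9 * N\<^sup>2, - 6 * q, - 3 * N], [- 6 * q, 6 * N, 0], [- 3 * N, 0, 3]] ! i ! j)"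
    (is "_ = ?M")
proof -
  have line: "(0, z) + t *\<^sub>R (1, 0, 0) = (t, z)" for t :: real
    by (simp add: plus_prod_def zero_prod_def[symmetric])
  have sum3: "(\<Sum>i<3. h i) = h 0 + h 1 + h 2" for h :: "nat \<Rightarrow> real"
    by (simp add: numeral_3_eq_3 numeral_2_eq_2)
  have identity: "((t ^ 3 - 3 * t * N + 2 * q) * (3 * s\<^sup>2 - 3 * N)
        - (3 * t\<^sup>2 - 3 * N) * (s ^ 3 - 3 * s * N + 2 * q)) / (t - s)
      = (\<Sum>i<3. \<Sum>j<3. ?M $$ (i, j) * t ^ i * s ^ j)" if "t \<noteq> s" for t s :: real
  proof -
    have "(t ^ 3 - 3 * t * N + 2 * q) * (3 * s\<^sup>2 - 3 * N)
        - (3 * t\<^sup>2 - 3 * N) * (s ^ 3 - 3 * s * N + 2 * q)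
      = (\<Sum>i<3. \<Sum>j<3. ?M $$ (i, j) * t ^ i * s ^ j) * (t - s)"
      by (simp add: sum3 power2_eq_square power3_eq_cube algebra_simps)
    then show ?thesis using that by simp
  qed
  show ?thesis
    unfolding bezoutian_def line graph_cubic_eq dir_deriv_graph_cubic N_def[symmetric] q_def[symmetric]
  proof (rule the_equality)
    show "?M \<in> carrier_mat 3 3 \<and> (\<forall>t s. t \<noteq> s \<longrightarrow>
        ((t ^ 3 - 3 * t * N + 2 * q) * (3 * s\<^sup>2 - 3 * N)
          - (3 * t\<^sup>2 - 3 * N) * (s ^ 3 - 3 * s * N + 2 * q)) / (t - s)
        = (\<Sum>i<3. \<Sum>j<3. ?M $$ (i, j) * t ^ i * s ^ j))"
      by (intro conjI allI impI mat_carrier identity)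
    fix B assume B: "B \<in> carrier_mat 3 3 \<and> (\<forall>t s. t \<noteq> s \<longrightarrow>
        ((t ^ 3 - 3 * t * N + 2 * q) * (3 * s\<^sup>2 - 3 * N)
          - (3 * t\<^sup>2 - 3 * N) * (s ^ 3 - 3 * s * N + 2 * q)) / (t - s)
        = (\<Sum>i<3. \<Sum>j<3. B $$ (i, j) * t ^ i * s ^ j))"
    show "B = ?M"
    proof (rule eq_matI)
      show "dim_row B = dim_row ?M" "dim_col B = dim_col ?M" using B by auto
      fix i j assume "i < dim_row ?M" "j < dim_col ?M"
      then have ij: "i < 3" "j < 3" by simp_all
      show "B $$ (i, j) = ?M $$ (i, j)"
      proof (rule bezoutian_coefficients_unique[OF _ ij])
        fix t s :: real assume "t \<noteq> s"
        then show "(\<Sum>i<3. \<Sum>j<3. B $$ (i, j) * t ^ i * s ^ j)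
            = (\<Sum>i<3. \<Sum>j<3. ?M $$ (i, j) * t ^ i * s ^ j)"
          using identity[of t s] conjunct2[OF B, rule_format, of t s] by argo
      qed
    qed
  qed
qed

section \<open>Obstruction from a wheel\<close>

text \<open>
  The vectors \<open>H\<close> and \<open>V\<^sub>j\<close> have \<open>m\<close> components, indexed by \<open>k\<close>. The certificate is a sum of
  five squares; its coefficients approximate the dual solution of the semidefinite program for
  Gram matrices that are invariant under the symmetries of the pentagon.
\<close>

lemma no_pentagon_gram:
  fixes H :: "nat \<Rightarrow> real" and V :: "nat \<Rightarrow> nat \<Rightarrow> real"
  assumes H: "(\<Sum>k<m. (H k)\<^sup>2) = 4"
    and V: "\<And>j. j < 5 \<Longrightarrow> (\<Sum>k<m. (V j k)\<^sup>2) = 9 / 2"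
    and HV: "\<And>j. j < 5 \<Longrightarrow> (\<Sum>k<m. (H k + V j k + V (Suc j mod 5) k)\<^sup>2) = 1"
  shows False
proof -
  have identity: "(133 * h + 132 * v0 + 66 * v1 + 66 * v4 - 11 * v2 - 11 * v3)\<^sup>2
      + (133 * h + 132 * v1 + 66 * v2 + 66 * v0 - 11 * v3 - 11 * v4)\<^sup>2
      + (133 * h + 132 * v2 + 66 * v3 + 66 * v1 - 11 * v4 - 11 * v0)\<^sup>2
      + (133 * h + 132 * v3 + 66 * v4 + 66 * v2 - 11 * v0 - 11 * v1)\<^sup>2
      + (133 * h + 132 * v4 + 66 * v0 + 66 * v3 - 11 * v1 - 11 * v2)\<^sup>2
    = 16093 * ((h + v0 + v1)\<^sup>2 + (h + v1 + v2)\<^sup>2 + (h + v2 + v3)\<^sup>2 + (h + v3 + v4)\<^sup>2 + (h + v4 + v0)\<^sup>2)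
      + 7980 * h\<^sup>2 - 5808 * (v0\<^sup>2 + v1\<^sup>2 + v2\<^sup>2 + v3\<^sup>2 + v4\<^sup>2)"
    for h v0 v1 v2 v3 v4 :: real
    by (simp add: power2_eq_square algebra_simps)
  have "0 \<le> (\<Sum>k<m. 16093 * ((H k + V 0 k + V 1 k)\<^sup>2 + (H k + V 1 k + V 2 k)\<^sup>2
        + (H k + V 2 k + V 3 k)\<^sup>2 + (H k + V 3 k + V 4 k)\<^sup>2 + (H k + V 4 k + V 0 k)\<^sup>2)
      + 7980 * (H k)\<^sup>2 - 5808 * ((V 0 k)\<^sup>2 + (V 1 k)\<^sup>2 + (V 2 k)\<^sup>2 + (V 3 k)\<^sup>2 + (V 4 k)\<^sup>2))"
    unfolding identity[symmetric] by (intro sum_nonneg add_nonneg_nonneg zero_le_power2)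
  also have "\<dots> = 16093 * 5 + 7980 * 4 - 5808 * (5 * (9 / 2))"
    using H V[of 0] V[of 1] V[of 2] V[of 3] V[of 4] HV[of 0] HV[of 1, unfolded Suc_1] HV[of 2]
      HV[of 3] HV[of 4]
    by (simp add: sum.distrib sum_subtractf sum_distrib_left[symmetric])
  finally show False by simp
qed

text \<open>
  An orthogonal basis of the space of the graph. The vectors of the vertices have length \<open>sqrt 2\<close>,
  so that the points \<open>triangle_point\<close> below have coefficients \<open>1\<close> and \<open>-1\<close>.
\<close>

definition vertex_vec :: "'v \<Rightarrow> (real ^ 'v::finite) \<times> (real ^ 'e::finite)" where
  "vertex_vec i = (sqrt 2 *\<^sub>R axis i 1, 0)"

definition edge_vec :: "'e \<Rightarrow> (real ^ 'v::finite) \<times> (real ^ 'e::finite)" where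
  "edge_vec e = (0, axis e 1)"

lemma inner_vertex_edge_vec:
  "vertex_vec i \<bullet> vertex_vec j = 2 * of_bool (i = j)"
  "edge_vec e \<bullet> edge_vec e' = of_bool (e = e')"
  "vertex_vec i \<bullet> edge_vec e = 0" "edge_vec e \<bullet> vertex_vec i = 0"
  by (simp_all add: vertex_vec_def edge_vec_def inner_axis_axis)

lemma norm_vertex_edge_vec: "(norm (vertex_vec i))\<^sup>2 = 2" "(norm (edge_vec e))\<^sup>2 = 1"
  by (simp_all add: power2_norm_eq_inner inner_vertex_edge_vec)

text \<open>
  Points on a triangle where \<open>q\<^sup>2\<close> attains its bound \<open>\<parallel>z\<parallel>\<^sup>6\<close>, if \<open>s\<close>, \<open>\<beta>\<close> and \<open>\<gamma>\<close> are signs. The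
  edges \<open>ab\<close>, \<open>ac\<close> and \<open>bc\<close> are those of the triangle; their signs are the products of the signs
  of their ends.
\<close>

definition triangle_point ::
  "'v::finite \<Rightarrow> 'v \<Rightarrow> 'v \<Rightarrow> 'e::finite \<Rightarrow> 'e \<Rightarrow> 'e \<Rightarrow> real \<Rightarrow> real \<Rightarrow> real
    \<Rightarrow> (real ^ 'v) \<times> (real ^ 'e)" where
  "triangle_point a b c ab ac bc s \<beta> \<gamma> =
     s *\<^sub>R (vertex_vec a + \<beta> *\<^sub>R vertex_vec b + \<gamma> *\<^sub>R vertex_vec c)
     + \<beta> *\<^sub>R edge_vec ab + \<gamma> *\<^sub>R edge_vec ac + (\<beta> * \<gamma>) *\<^sub>R edge_vec bc"

context
  fixes E :: "'e::finite \<Rightarrow> 'v::finite set" and a b c :: 'v and ab ac bc :: 'e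
  assumes card: "\<And>e. card (E e) = 2"
    and ab: "E ab = {a, b}" and ac: "E ac = {a, c}" and bc: "E bc = {b, c}"
begin

lemma triangle_distinct: "a \<noteq> b" "a \<noteq> c" "b \<noteq> c" "ab \<noteq> ac" "ab \<noteq> bc" "ac \<noteq> bc"
proof -
  show *: "a \<noteq> b" "a \<noteq> c" "b \<noteq> c" using card[of ab] card[of ac] card[of bc] ab ac bc by auto
  then show "ab \<noteq> ac" "ab \<noteq> bc" "ac \<noteq> bc" using ab ac bc by (auto simp: doubleton_eq_iff)
qed

lemma triangle_point_extremal:
  assumes signs: "s \<in> {1, -1}" "\<beta> \<in> {1, -1}" "\<gamma> \<in> {1, -1}"
  defines "z \<equiv> triangle_point a b c ab ac bc s \<beta> \<gamma>"
  shows "(norm z)\<^sup>2 = 9" "edge_form E z = 27"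
proof -
  show "(norm z)\<^sup>2 = 9"
    using signs triangle_distinct
    by (auto simp: z_def triangle_point_def power2_norm_eq_inner inner_vertex_edge_vec
        inner_add_left inner_add_right inner_diff_left inner_diff_right)
  have vertices: "fst z $ a = sqrt 2 * s" "fst z $ b = sqrt 2 * s * \<beta>" "fst z $ c = sqrt 2 * s * \<gamma>"
    using triangle_distinct
    by (auto simp: z_def triangle_point_def vertex_vec_def edge_vec_def axis_def)
  have edges: "snd z $ e = \<beta> * of_bool (e = ab) + \<gamma> * of_bool (e = ac) + \<beta> * \<gamma> * of_bool (e = bc)" for e
    by (auto simp: z_def triangle_point_def vertex_vec_def edge_vec_def axis_def)
  have pick: "(\<Sum>e\<in>UNIV. h e * (x * of_bool (e = e'))) = h e' * x" for h :: "'e \<Rightarrow> real" and x e'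
    by (simp add: of_bool_def if_distrib cong: if_cong
        del: sum_mult_of_bool_eq sum_of_bool_mult_eq)
  have "edge_form E z = 9 / 2 * ((\<Prod>i\<in>{a, b}. fst z $ i) * \<beta> + (\<Prod>i\<in>{a, c}. fst z $ i) * \<gamma>
      + (\<Prod>i\<in>{b, c}. fst z $ i) * (\<beta> * \<gamma>))"
    unfolding edge_form_def edges distrib_left sum.distrib pick ab ac bc ..
  also have "\<dots> = 27"
    using triangle_distinct signs by (auto simp: vertices)
  finally show "edge_form E z = 27" .
qed

text \<open>Summation over the signs extracts two relations from \<open>f = 3 l\<close> at these points.\<close>

lemma triangle_relations:
  assumes B: "bilinear B" and sym: "\<And>x y. B x y = B y x" and l: "linear l"
    and eq: "\<And>s \<beta> \<gamma>. s \<in> {1, -1} \<Longrightarrow> \<beta> \<in> {1, -1} \<Longrightarrow> \<gamma> \<in> {1, -1} \<Longrightarrow>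
      B (triangle_point a b c ab ac bc s \<beta> \<gamma>) (triangle_point a b c ab ac bc s \<beta> \<gamma>)
        = 3 * l (triangle_point a b c ab ac bc s \<beta> \<gamma>)"
  shows "2 * (B (vertex_vec b) (edge_vec ab) + B (vertex_vec c) (edge_vec ac))
      = 3 * l (vertex_vec a)"
    and "B (vertex_vec a) (vertex_vec a) + B (vertex_vec b) (vertex_vec b)
      + B (vertex_vec c) (vertex_vec c) + B (edge_vec ab) (edge_vec ab)
      + B (edge_vec ac) (edge_vec ac) + B (edge_vec bc) (edge_vec bc) = (0 :: real)"
proof -
  define x where "x = (\<lambda>\<beta> \<gamma> :: real. vertex_vec a + \<beta> *\<^sub>R vertex_vec b + \<gamma> *\<^sub>R vertex_vec c
    :: (real ^ 'v) \<times> (real ^ 'e))"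
  define y where "y = (\<lambda>\<beta> \<gamma> :: real. \<beta> *\<^sub>R edge_vec ab + \<gamma> *\<^sub>R edge_vec ac + (\<beta> * \<gamma>) *\<^sub>R edge_vec bc
    :: (real ^ 'v) \<times> (real ^ 'e))"
  note expand = bilinear_ladd[OF B] bilinear_radd[OF B] bilinear_lmul[OF B] bilinear_rmul[OF B]
    bilinear_lneg[OF B] bilinear_rneg[OF B] bilinear_lsub[OF B] bilinear_rsub[OF B]
    linear_add[OF l] linear_scale[OF l] linear_neg[OF l] linear_diff[OF l]
  have pt: "triangle_point a b c ab ac bc s \<beta> \<gamma> = s *\<^sub>R x \<beta> \<gamma> + y \<beta> \<gamma>" for s \<beta> \<gamma>
    by (simp add: triangle_point_def x_def y_def)
  have split: "2 * B (x \<beta> \<gamma>) (y \<beta> \<gamma>) = 3 * l (x \<beta> \<gamma>)"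
      "B (x \<beta> \<gamma>) (x \<beta> \<gamma>) + B (y \<beta> \<gamma>) (y \<beta> \<gamma>) = 3 * l (y \<beta> \<gamma>)"
    if "\<beta> \<in> {1, -1}" "\<gamma> \<in> {1, -1}" for \<beta> \<gamma>
    using eq[of 1, OF _ that] eq[of "-1", OF _ that] sym[of "y \<beta> \<gamma>" "x \<beta> \<gamma>"]
    by (simp_all add: pt expand)
  show "2 * (B (vertex_vec b) (edge_vec ab) + B (vertex_vec c) (edge_vec ac)) = 3 * l (vertex_vec a)"
    using split(1)[of 1 1] split(1)[of 1 "-1"] split(1)[of "-1" 1] split(1)[of "-1" "-1"]
    by (simp add: x_def y_def expand algebra_simps)
  show "B (vertex_vec a) (vertex_vec a) + B (vertex_vec b) (vertex_vec b)
      + B (vertex_vec c) (vertex_vec c) + B (edge_vec ab) (edge_vec ab)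
      + B (edge_vec ac) (edge_vec ac) + B (edge_vec bc) (edge_vec bc) = 0"
    using split(2)[of 1 1] split(2)[of 1 "-1"] split(2)[of "-1" 1] split(2)[of "-1" "-1"]
    by (simp add: x_def y_def expand algebra_simps)
qed

end

text \<open>
  The graph may be any graph that contains a wheel with five spokes, given as a hub \<open>h\<close> and a closed
  walk \<open>r\<close> of length five through its neighbours.
\<close>

lemma wheel_obstruction:
  fixes E :: "'e::finite \<Rightarrow> 'v::finite set"
    and f l :: "nat \<Rightarrow> (real ^ 'v) \<times> (real ^ 'e) \<Rightarrow> real" and r :: "nat \<Rightarrow> 'v"
  assumes card: "\<And>e. card (E e) = 2"
    and spokes: "\<And>i. i < 5 \<Longrightarrow> {h, r i} \<in> range E"
    and rim: "\<And>i. i < 5 \<Longrightarrow> {r i, r (Suc i mod 5)} \<in> range E"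
    and poly_f: "\<And>k. k < m \<Longrightarrow> real_polynomial_function (f k)"
    and poly_l: "\<And>k. k < m \<Longrightarrow> real_polynomial_function (l k)"
    and ff: "\<And>z. (\<Sum>k<m. (f k z)\<^sup>2) = ((norm z)\<^sup>2)\<^sup>2"
    and fl: "\<And>z. (\<Sum>k<m. f k z * l k z) = edge_form E z"
    and ll: "\<And>z. (\<Sum>k<m. (l k z)\<^sup>2) = (norm z)\<^sup>2"
  shows False
proof -
  have "(f k z)\<^sup>2 \<le> ((norm z)\<^sup>2)\<^sup>2" if "k < m" for k z
    unfolding ff[symmetric] using that by (intro member_le_sum) auto
  then have f_bound: "\<bar>f k z\<bar> \<le> (norm z)\<^sup>2" if "k < m" for k z
    using that by (metis abs_le_square_iff abs_of_nonneg zero_le_power2)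
  have "(l k z)\<^sup>2 \<le> (norm z)\<^sup>2" if "k < m" for k z
    unfolding ll[symmetric] using that by (intro member_le_sum) auto
  then have l_bound: "\<bar>l k z\<bar> \<le> norm z" if "k < m" for k z
    using that by (metis abs_le_square_iff abs_of_nonneg norm_ge_zero)
  have lin: "linear (l k)" if "k < m" for k
    using linear_if_linear_growth[OF poly_l l_bound] that by blast
  have "\<exists>B. k < m \<longrightarrow> bilinear B \<and> (\<forall>x y. B x y = B y x) \<and> (\<forall>x. f k x = B x x)" for k
    using bilinear_if_quadratic_growth[OF poly_f f_bound] by metis
  then obtain B where B: "\<And>k. k < m \<Longrightarrow> bilinear (B k)" "\<And>k x y. k < m \<Longrightarrow> B k x y = B k y x"
    "\<And>k x. k < m \<Longrightarrow> f k x = B k x x" by metis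
  have extremal: "f k z = 3 * l k z" if "(norm z)\<^sup>2 = 9" "edge_form E z = 27" "k < m" for k z
  proof -
    have "(\<Sum>k<m. (f k z - 3 * l k z)\<^sup>2)
        = (\<Sum>k<m. (f k z)\<^sup>2) - 6 * (\<Sum>k<m. f k z * l k z) + 9 * (\<Sum>k<m. (l k z)\<^sup>2)"
      by (simp add: power2_diff sum.distrib sum_subtractf sum_distrib_left power_mult_distrib mult_ac)
    also have "\<dots> = 0" unfolding ff fl ll that(1,2) by simp
    finally show ?thesis using that(3) by (subst (asm) sum_nonneg_eq_0_iff) auto
  qed
  have "\<forall>i. \<exists>e. i < 5 \<longrightarrow> E e = {h, r i}" using spokes by (metis imageE)
  then obtain e where e: "\<And>i. i < 5 \<Longrightarrow> E (e i) = {h, r i}" by metis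
  have "\<forall>i. \<exists>e. i < 5 \<longrightarrow> E e = {r i, r (Suc i mod 5)}" using rim by (metis imageE)
  then obtain g where g: "\<And>i. i < 5 \<Longrightarrow> E (g i) = {r i, r (Suc i mod 5)}" by metis
  have relations: "2 * (B k (vertex_vec (r i)) (edge_vec (e i))
        + B k (vertex_vec (r (Suc i mod 5))) (edge_vec (e (Suc i mod 5)))) = 3 * l k (vertex_vec h)"
      "f k (vertex_vec h) + f k (vertex_vec (r i)) + f k (vertex_vec (r (Suc i mod 5)))
        + f k (edge_vec (e i)) + f k (edge_vec (e (Suc i mod 5))) + f k (edge_vec (g i)) = 0"
    if i: "i < 5" and k: "k < m" for i k
  proof -
    have E: "E (e i) = {h, r i}" "E (e (Suc i mod 5)) = {h, r (Suc i mod 5)}"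
      "E (g i) = {r i, r (Suc i mod 5)}" using i e g by simp_all
    have "B k (triangle_point h (r i) (r (Suc i mod 5)) (e i) (e (Suc i mod 5)) (g i) s \<beta> \<gamma>)
        (triangle_point h (r i) (r (Suc i mod 5)) (e i) (e (Suc i mod 5)) (g i) s \<beta> \<gamma>)
      = 3 * l k (triangle_point h (r i) (r (Suc i mod 5)) (e i) (e (Suc i mod 5)) (g i) s \<beta> \<gamma>)"
      if "s \<in> {1, -1}" "\<beta> \<in> {1, -1}" "\<gamma> \<in> {1, -1}" for s \<beta> \<gamma>
      using extremal triangle_point_extremal[of E, OF card E that] k B(3) by metis
    note triangle_relations[of E, OF card E B(1)[OF k] B(2)[OF k] lin[OF k] this]
    then show "2 * (B k (vertex_vec (r i)) (edge_vec (e i))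
        + B k (vertex_vec (r (Suc i mod 5))) (edge_vec (e (Suc i mod 5)))) = 3 * l k (vertex_vec h)"
      "f k (vertex_vec h) + f k (vertex_vec (r i)) + f k (vertex_vec (r (Suc i mod 5)))
        + f k (edge_vec (e i)) + f k (edge_vec (e (Suc i mod 5))) + f k (edge_vec (g i)) = 0"
      by (simp_all add: B(3)[OF k])
  qed
  \<comment> \<open>The rim is an odd cycle, so the first relation determines its summands.\<close>
  have cross: "B k (vertex_vec (r i)) (edge_vec (e i)) = 3 / 4 * l k (vertex_vec h)"
    if i: "i < 5" and k: "k < m" for i k
  proof -
    have "i \<in> {0, 1, 2, 3, 4}" using i by auto
    then show ?thesis
      using relations(1)[OF _ k, of 0] relations(1)[OF _ k, of 1] relations(1)[OF _ k, of 2]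
        relations(1)[OF _ k, of 3] relations(1)[OF _ k, of 4]
      by (auto simp: numeral_2_eq_2)
  qed
  have vertex_edge: "(\<Sum>k<m. f k (vertex_vec (r i)) * f k (edge_vec (e i))) = - 1 / 4"
    if i: "i < 5" for i
  proof -
    let ?u = "vertex_vec (r i) :: (real ^ 'v) \<times> (real ^ 'e)"
    let ?w = "edge_vec (e i) :: (real ^ 'v) \<times> (real ^ 'e)"
    have "(f k (?u + ?w))\<^sup>2 + (f k (?u - ?w))\<^sup>2 = 2 * (f k ?u)\<^sup>2 + 2 * (f k ?w)\<^sup>2
        + 4 * (f k ?u * f k ?w) + 9 / 2 * (l k (vertex_vec h))\<^sup>2" if k: "k < m" for k
    proof -
      have sums: "f k (?u + ?w) = f k ?u + f k ?w + 2 * B k ?u ?w"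
        "f k (?u - ?w) = f k ?u + f k ?w - 2 * B k ?u ?w"
        using B(2)[OF k, of ?w ?u]
        by (simp_all add: B(3)[OF k] bilinear_ladd[OF B(1)[OF k]] bilinear_radd[OF B(1)[OF k]]
            bilinear_lsub[OF B(1)[OF k]] bilinear_rsub[OF B(1)[OF k]])
      show ?thesis
        unfolding sums cross[OF i k] by (simp add: power2_eq_square algebra_simps)
    qed
    then have "(\<Sum>k<m. (f k (?u + ?w))\<^sup>2) + (\<Sum>k<m. (f k (?u - ?w))\<^sup>2)
        = 2 * (\<Sum>k<m. (f k ?u)\<^sup>2) + 2 * (\<Sum>k<m. (f k ?w)\<^sup>2)
          + 4 * (\<Sum>k<m. f k ?u * f k ?w) + 9 / 2 * (\<Sum>k<m. (l k (vertex_vec h))\<^sup>2)"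
      by (simp add: sum.distrib[symmetric] sum_distrib_left)
    moreover have "(norm (?u + ?w))\<^sup>2 = 3" "(norm (?u - ?w))\<^sup>2 = 3"
      by (simp_all add: power2_norm_eq_inner inner_vertex_edge_vec inner_add_left inner_add_right
          inner_diff_left inner_diff_right)
    ultimately show ?thesis unfolding ff ll by (simp add: norm_vertex_edge_vec)
  qed
  define V where "V = (\<lambda>i k. f k (vertex_vec (r i)) + f k (edge_vec (e i)))"
  show False
  proof (rule no_pentagon_gram)
    show "(\<Sum>k<m. (f k (vertex_vec h))\<^sup>2) = 4"
      by (simp add: ff norm_vertex_edge_vec)
    show "(\<Sum>k<m. (V i k)\<^sup>2) = 9 / 2" if i: "i < 5" for i
    proof -
      have "(\<Sum>k<m. (V i k)\<^sup>2) = (\<Sum>k<m. (f k (vertex_vec (r i)))\<^sup>2) + (\<Sum>k<m. (f k (edge_vec (e i)))\<^sup>2)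
          + 2 * (\<Sum>k<m. f k (vertex_vec (r i)) * f k (edge_vec (e i)))"
        by (simp add: V_def power2_sum sum.distrib sum_distrib_left mult_ac)
      then show ?thesis by (simp add: ff vertex_edge[OF i] norm_vertex_edge_vec)
    qed
    show "(\<Sum>k<m. (f k (vertex_vec h) + V i k + V (Suc i mod 5) k)\<^sup>2) = 1" if i: "i < 5" for i
    proof -
      have "f k (vertex_vec h) + V i k + V (Suc i mod 5) k = - f k (edge_vec (g i))" if "k < m" for k
        using relations(2)[OF i that] by (simp add: V_def)
      then have "(\<Sum>k<m. (f k (vertex_vec h) + V i k + V (Suc i mod 5) k)\<^sup>2)
          = (\<Sum>k<m. (f k (edge_vec (g i)))\<^sup>2)" by simp
      then show ?thesis by (simp add: ff norm_vertex_edge_vec)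
    qed
  qed
qed

text \<open>
  A completion of squares in the last index turns a matrix sum of squares into the forms \<open>f\<^sub>k\<close>
  and \<open>l\<^sub>k\<close> that a wheel excludes.
\<close>

lemma bezoutian_not_matrix_sos:
  fixes E :: "'e::finite \<Rightarrow> 'v::finite set" and r :: "nat \<Rightarrow> 'v"
  assumes card: "\<And>e. card (E e) = 2"
    and spokes: "\<And>i. i < 5 \<Longrightarrow> {h, r i} \<in> range E"
    and rim: "\<And>i. i < 5 \<Longrightarrow> {r i, r (Suc i mod 5)} \<in> range E"
  shows "\<not> matrix_sos 3 (\<lambda>x. bezoutian 3 (graph_cubic E) (1, 0, 0) x (1, 0, 0))"
proof
  assume "matrix_sos 3 (\<lambda>x. bezoutian 3 (graph_cubic E) (1, 0, 0) x (1, 0, 0))"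
  then obtain m and Q :: "real \<times> (real ^ 'v) \<times> (real ^ 'e) \<Rightarrow> real mat" where
    carrier: "\<And>x. Q x \<in> carrier_mat 3 m"
    and poly: "\<And>i k. i < 3 \<Longrightarrow> k < m \<Longrightarrow> real_polynomial_function (\<lambda>x. Q x $$ (i, k))"
    and QQ: "\<And>x. bezoutian 3 (graph_cubic E) (1, 0, 0) x (1, 0, 0) = Q x * transpose_mat (Q x)"
    unfolding matrix_sos_def by metis
  define R where "R = (\<lambda>i k z. Q (0, z) $$ (i, k))"
  have R_poly: "real_polynomial_function (R i k)" if "i < 3" "k < m" for i k
  proof -
    have "polynomial_function (\<lambda>z :: (real ^ 'v) \<times> (real ^ 'e). (0 :: real, z))"
      by (intro polynomial_function_bounded_linear bounded_linear_Pair bounded_linear_zero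
          bounded_linear_ident)
    from real_polynomial_function_compose[OF this poly[OF that]]
    show ?thesis by (simp add: R_def comp_def)
  qed
  have RR: "(\<Sum>k<m. R i k z * R j k z)
      = [[9 * ((norm z)\<^sup>2)\<^sup>2, - 6 * edge_form E z, - 3 * (norm z)\<^sup>2],
         [- 6 * edge_form E z, 6 * (norm z)\<^sup>2, 0], [- 3 * (norm z)\<^sup>2, 0, 3]] ! i ! j"
    if "i < 3" "j < 3" for i j z
  proof -
    have "(\<Sum>k<m. R i k z * R j k z) = (Q (0, z) * transpose_mat (Q (0, z))) $$ (i, j)"
      using that carrier[of "(0, z)"]
      by (simp add: R_def scalar_prod_def atLeast0LessThan)
    then show ?thesis using that unfolding QQ[symmetric] bezoutian_graph_cubic by simp
  qed
  define f where "f = (\<lambda>k z. (R 0 k z + (norm z)\<^sup>2 * R 2 k z) / sqrt 6)"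
  define l where "l = (\<lambda>k z. - R 1 k z / sqrt 6)"
  have norm_poly: "real_polynomial_function (\<lambda>z :: (real ^ 'v) \<times> (real ^ 'e). (norm z)\<^sup>2)"
    unfolding power2_norm_eq_inner by (subst euclidean_inner)
      (intro real_polynomial_function_sum real_polynomial_function.intros(4)
        real_polynomial_function.intros(1)[OF bounded_linear_inner_left] finite_Basis)
  show False
  proof (rule wheel_obstruction[where f = f and l = l and E = E and r = r])
    show "real_polynomial_function (f k)" if "k < m" for k
      unfolding f_def using R_poly that norm_poly
      by (intro real_polynomial_function_divide real_polynomial_function.intros(3,4)) auto
    show "real_polynomial_function (l k)" if "k < m" for k
      unfolding l_def using R_poly that
      by (intro real_polynomial_function_divide real_polynomial_function_minus) auto
    fix z :: "(real ^ 'v) \<times> (real ^ 'e)"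
    have "(\<Sum>k<m. (f k z)\<^sup>2) = ((\<Sum>k<m. R 0 k z * R 0 k z)
        + 2 * (norm z)\<^sup>2 * (\<Sum>k<m. R 0 k z * R 2 k z)
        + ((norm z)\<^sup>2)\<^sup>2 * (\<Sum>k<m. R 2 k z * R 2 k z)) / 6"
      by (simp add: f_def power_divide sum_divide_distrib[symmetric] sum_distrib_left
          sum.distrib[symmetric]) (simp add: power2_eq_square power4_eq_xxxx algebra_simps)
    then show "(\<Sum>k<m. (f k z)\<^sup>2) = ((norm z)\<^sup>2)\<^sup>2"
      unfolding RR[of 0 0, simplified] RR[of 0 2, simplified] RR[of 2 2, simplified]
      by (simp add: power2_eq_square power4_eq_xxxx)
    have "f k z * l k z = - 1 / 6 * (R 0 k z * R 1 k z)
        + (- 1 / 6 * (norm z)\<^sup>2) * (R 2 k z * R 1 k z)" for k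
      by (simp add: f_def l_def field_simps)
    then have "(\<Sum>k<m. f k z * l k z) = - 1 / 6 * (\<Sum>k<m. R 0 k z * R 1 k z)
        + (- 1 / 6 * (norm z)\<^sup>2) * (\<Sum>k<m. R 2 k z * R 1 k z)"
      by (simp only: sum.distrib sum_distrib_left)
    then show "(\<Sum>k<m. f k z * l k z) = edge_form E z"
      using RR[of 0 1 z] RR[of 2 1 z] by simp
    have "(\<Sum>k<m. (l k z)\<^sup>2) = (\<Sum>k<m. R 1 k z * R 1 k z) / 6"
      by (simp add: l_def power_divide sum_divide_distrib[symmetric] power2_eq_square)
    then show "(\<Sum>k<m. (l k z)\<^sup>2) = (norm z)\<^sup>2"
      using RR[of 1 1 z] by simp
  qed (use card spokes rim in simp_all)
qed

section \<open>The icosahedral cubic\<close>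

theorem theorem5p6:
  fixes p :: "real \<times> (real ^ ico_vertex) \<times> (real ^ ico_edge) \<Rightarrow> real"
    and e0 :: "real \<times> (real ^ ico_vertex) \<times> (real ^ ico_edge)"
  assumes "p = graph_cubic ico_ends"
    and "e0 = (1, 0, 0)"
  shows "hyperbolic 3 p e0 \<and> \<not> SOS_hyperbolic 3 p e0"
proof
  show "hyperbolic 3 p e0"
    unfolding assms using inj_ico_ends card_ico_ends ico_clique_card
    by (rule graph_cubic_hyperbolic)
  have cone: "e0 \<in> hyperbolicity_cone p e0"
  proof -
    have "t *\<^sub>R e0 - e0 = (t - 1, 0)" for t
      by (simp add: assms(2) zero_prod_def)
    then have "p (t *\<^sub>R e0 - e0) = (t - 1) ^ 3" for t
      by (simp add: assms(1) graph_cubic_eq edge_form_def)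
    then show ?thesis by (simp add: hyperbolicity_cone_def)
  qed
  obtain h r where wheel: "\<And>i. i < 5 \<Longrightarrow> {h, r i} \<in> range ico_ends"
    "\<And>i. i < 5 \<Longrightarrow> {r i, r (Suc i mod 5)} \<in> range ico_ends"
    using ico_wheel by metis
  have not_sos: "\<not> matrix_sos 3 (\<lambda>x. bezoutian 3 p e0 x e0)"
    unfolding assms by (rule bezoutian_not_matrix_sos[of ico_ends h r])
      (simp_all add: card_ico_ends wheel)
  show "\<not> SOS_hyperbolic 3 p e0"
  proof
    assume "SOS_hyperbolic 3 p e0"
    then have "\<forall>u\<in>hyperbolicity_cone p e0. matrix_sos 3 (\<lambda>x. bezoutian 3 p e0 x u)"
      unfolding SOS_hyperbolic_def by (rule conjunct2)
    from bspec[OF this cone] not_sos show False by (rule notE[rotated])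
  qed
qed

end
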